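(* Let $X$ be a separable, smooth and locally uniformly convex complex Banach space. Then the set of all functions in $\mathcal{A}_u(B_X:X)$ that are both (norm) strong peak functions and numerical strong peak functions is a dense $G_\delta$ subset of $\mathcal{A}_u(B_X:X)$.
   Context: $B_X$ and $S_X$ are the closed unit ball and unit sphere of $X$. $X$ is smooth if for every $x\in S_X$ there is a unique $x^*\in B_{X^*}$ with $\operatorname{Re}x^*(x)=1$. $\mathcal{A}_u(B_X:X)$ is the Banach space of bounded, uniformly continuous functions $f:B_X\to X$ that are holomorphic on the interior of $B_X$, with norm $\|f\|=\sup_{x\in B_X}\|f(x)\|$. A nonzero $f\in\mathcal{A}_u(B_X:X)$ is a (norm) strong peak function if there is $t\in B_X$ such that every sequence $(t_k)$ in $B_X$ with $\lim_k\|f(t_k)\|=\|f\|$ converges to $t$. $\Pi(X)=\{(x,x^* )\in B_X\times B_{X^*}:x^*(x)=1\}$ has the subspace topology from $B_X\times B_{X^*}$, where $B_X$ carries the norm topology and $B_{X^*}$ the weak-$*$ topology. The numerical radius of $f\in\mathcal{A}_u(B_X:X)$ is $v(f)=\sup\{|x^*f(x)|:(x,x^* )\in\Pi(X)\}$. A function $f\in\mathcal{A}_u(B_X:X)$ is a numerical strong peak function if there is $(x,x^* )\in\Pi(X)$ such that every sequence $((x_n,x_n^* ))$ in $\Pi(X)$ with $\lim_n|x_n^*f(x_n)|=v(f)$ converges to $(x,x^* )$ in $\Pi(X)$. *)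

theory Defs
  imports "HOL-Analysis.Analysis"
begin

section \<open>Complex Banach spaces\<close>

class scaleC = scaleR +
  fixes scaleC :: "complex \<Rightarrow> 'a \<Rightarrow> 'a"  (infixr \<open>*\<^sub>C\<close> 75)
  assumes scaleR_scaleC: "r *\<^sub>R x = complex_of_real r *\<^sub>C x"

class complex_normed_vector = scaleC + real_normed_vector +
  assumes scaleC_add_right: "a *\<^sub>C (x + y) = a *\<^sub>C x + a *\<^sub>C y"
    and scaleC_add_left: "(a + b) *\<^sub>C x = a *\<^sub>C x + b *\<^sub>C x"
    and scaleC_scaleC: "a *\<^sub>C (b *\<^sub>C x) = (a * b) *\<^sub>C x"
    and scaleC_one: "1 *\<^sub>C x = x"
    and norm_scaleC: "norm (a *\<^sub>C x) = cmod a * norm x"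

class complex_banach = complex_normed_vector + complete_space

subclass (in complex_banach) banach ..

instantiation complex :: complex_banach
begin

definition scaleC_complex :: "complex \<Rightarrow> complex \<Rightarrow> complex"
  where "scaleC_complex a x = a * x"

instance
  by standard (auto simp: scaleC_complex_def scaleR_conv_of_real algebra_simps norm_mult)

end

section \<open>The dual ball and the geometry of the space\<close>

text \<open>
  The type of bounded linear functionals \<open>'a \<Rightarrow>\<^sub>L complex\<close> only provides real linearity,
  so complex homogeneity is imposed separately; the norm is the operator norm.
\<close>

definition dual_ball :: "('a::complex_normed_vector \<Rightarrow>\<^sub>L complex) set" where
  "dual_ball = {\<phi>. (\<forall>c x. blinfun_apply \<phi> (c *\<^sub>C x) = c * blinfun_apply \<phi> x) \<and> norm \<phi> \<le> 1}"

text \<open>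
  For scalar-valued maps the strong operator topology, i.e. the topology of pointwise
  convergence, is the weak-* topology.
\<close>

definition weak_star_dual_ball :: "('a::complex_normed_vector \<Rightarrow>\<^sub>L complex) topology" where
  "weak_star_dual_ball = subtopology strong_operator_topology dual_ball"

definition smooth_space :: "'a::complex_normed_vector itself \<Rightarrow> bool" where
  "smooth_space _ \<longleftrightarrow>
     (\<forall>x::'a. norm x = 1 \<longrightarrow> (\<exists>!\<phi>. \<phi> \<in> dual_ball \<and> Re (blinfun_apply \<phi> x) = 1))"

definition locally_uniformly_convex :: "'a::real_normed_vector itself \<Rightarrow> bool" where
  "locally_uniformly_convex _ \<longleftrightarrow>
     (\<forall>(x::'a) s. norm x = 1 \<and> (\<forall>n::nat. norm (s n) \<le> 1) \<and>
        (\<lambda>n. norm (s n + x)) \<longlonglongrightarrow> 2 \<longrightarrow> s \<longlonglongrightarrow> x)"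

section \<open>The space of functions\<close>

text \<open>Holomorphy is Frechet differentiability with a complex linear derivative.\<close>

definition holomorphic_map_on ::
    "('a::complex_normed_vector \<Rightarrow> 'b::complex_normed_vector) \<Rightarrow> 'a set \<Rightarrow> bool" where
  "holomorphic_map_on f U \<longleftrightarrow>
     (\<forall>x\<in>U. \<exists>D. (f has_derivative D) (at x) \<and> (\<forall>c y. D (c *\<^sub>C y) = c *\<^sub>C D y))"

text \<open>
  A function with domain the closed unit ball is represented by a total function that takes
  the value \<^const>\<open>undefined\<close> outside the ball.
\<close>

definition Au :: "('a::complex_normed_vector \<Rightarrow> 'a) set" where
  "Au = {f \<in> extensional (cball 0 1).
           bounded (f ` cball 0 1) \<and> uniformly_continuous_on (cball 0 1) f \<and>
           holomorphic_map_on f (interior (cball 0 1))}"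

definition Au_norm :: "('a::complex_normed_vector \<Rightarrow> 'a) \<Rightarrow> real" where
  "Au_norm f = (SUP x\<in>cball 0 1. norm (f x))"

text \<open>The metric on \<^const>\<open>funspace\<close> is the supremum metric, see \<open>mdist_Au\<close> below.\<close>

definition Au_metric :: "('a::complex_normed_vector \<Rightarrow> 'a) metric" where
  "Au_metric = submetric (funspace (cball 0 1) euclidean_metric) Au"

abbreviation Au_topology :: "('a::complex_normed_vector \<Rightarrow> 'a) topology" where
  "Au_topology \<equiv> mtopology_of Au_metric"

lemma Au_subset_funspace:
  "Au \<subseteq> mspace (funspace (cball 0 1) (euclidean_metric :: 'a::complex_normed_vector metric))"
  by (auto simp: Au_def Met_TC.fspace_def)

lemma mspace_Au [simp]: "mspace Au_metric = Au"
  using Au_subset_funspace by (auto simp: Au_metric_def)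

lemma mdist_Au:
  assumes "f \<in> Au" "g \<in> Au"
  shows "mdist Au_metric f g = Au_norm (\<lambda>x. f x - g x)"
  using assms Au_subset_funspace
  by (auto simp: Au_metric_def Au_norm_def Met_TC.fdist_def dist_norm)

section \<open>Peak functions\<close>

definition strong_peak_function :: "('a::complex_normed_vector \<Rightarrow> 'a) \<Rightarrow> bool" where
  "strong_peak_function f \<longleftrightarrow>
     f \<in> Au \<and> (\<exists>x\<in>cball 0 1. f x \<noteq> 0) \<and>
     (\<exists>t\<in>cball 0 1. \<forall>s::nat \<Rightarrow> 'a.
        (\<forall>k. s k \<in> cball 0 1) \<and> (\<lambda>k. norm (f (s k))) \<longlonglongrightarrow> Au_norm f \<longrightarrow> s \<longlonglongrightarrow> t)"

definition state_pairs :: "('a::complex_normed_vector \<times> ('a \<Rightarrow>\<^sub>L complex)) set" where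
  "state_pairs = {(x, \<phi>). x \<in> cball 0 1 \<and> \<phi> \<in> dual_ball \<and> blinfun_apply \<phi> x = 1}"

definition state_pairs_topology ::
    "('a::complex_normed_vector \<times> ('a \<Rightarrow>\<^sub>L complex)) topology" where
  "state_pairs_topology =
     subtopology (prod_topology (top_of_set (cball 0 1)) weak_star_dual_ball) state_pairs"

definition numerical_radius :: "('a::complex_normed_vector \<Rightarrow> 'a) \<Rightarrow> real" where
  "numerical_radius f = (SUP (x, \<phi>)\<in>state_pairs. cmod (blinfun_apply \<phi> (f x)))"

definition numerical_strong_peak_function :: "('a::complex_normed_vector \<Rightarrow> 'a) \<Rightarrow> bool" where
  "numerical_strong_peak_function f \<longleftrightarrow>
     f \<in> Au \<and>
     (\<exists>p\<in>state_pairs. \<forall>s::nat \<Rightarrow> 'a \<times> ('a \<Rightarrow>\<^sub>L complex).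
        (\<forall>n. s n \<in> state_pairs) \<and>
        (\<lambda>n. cmod (blinfun_apply (snd (s n)) (f (fst (s n))))) \<longlonglongrightarrow> numerical_radius f
        \<longrightarrow> limitin state_pairs_topology s p sequentially)"

end

theory Submission
  imports Defs "HOL-Complex_Analysis.Conformal_Mappings"
begin

text \<open>
  A function is a strong peak function, in either sense, iff for every \<open>n\<close> the points (or states) at
  which its modulus exceeds some level below the supremum have base points within \<open>1/n\<close> of each
  other. For fixed \<open>n\<close> this is an open condition. It is also dense: at a point \<open>x\<^sub>0\<close> of the unit
  sphere with support functional \<open>\<phi>\<close> where the modulus of \<open>f\<close> is almost maximal, the perturbation
  \<open>f + d ((1 + \<phi>)/2)\<^sup>N u\<close> with a suitable unit vector \<open>u\<close> raises the value at \<open>x\<^sub>0\<close> by \<open>d\<close>, and by local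
  uniform convexity it raises values away from \<open>x\<^sub>0\<close> by at most \<open>d/2\<close> once \<open>N\<close> is large. Baire's
  theorem finishes the proof. Smoothness makes the duality map single-valued, hence norm to weak-*
  continuous by compactness, so that for states only the convergence of the base points matters; it
  also provides norming functionals, for which no complex Hahn-Banach theorem is needed.
\<close>

section \<open>Norming functionals and holomorphic maps\<close>

lemma bounded_bilinear_scaleC:
  "bounded_bilinear (scaleC :: complex \<Rightarrow> 'a::complex_normed_vector \<Rightarrow> 'a)"
proof
  fix r :: real and a :: complex and x :: 'a
  show "(r *\<^sub>R a) *\<^sub>C x = r *\<^sub>R (a *\<^sub>C x)"
    unfolding scaleR_conv_of_real by (simp add: scaleR_scaleC scaleC_scaleC)
  show "a *\<^sub>C (r *\<^sub>R x) = r *\<^sub>R (a *\<^sub>C x)"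
    by (simp add: scaleR_scaleC scaleC_scaleC mult.commute)
  show "\<exists>K. \<forall>a (x::'a). norm (a *\<^sub>C x) \<le> norm a * norm x * K"
    by (rule exI[of _ 1]) (simp add: norm_scaleC)
qed (simp_all add: scaleC_add_left scaleC_add_right)

lemma dual_ball_scaleC: "\<phi> \<in> dual_ball \<Longrightarrow> \<phi> (c *\<^sub>C x) = c * \<phi> x"
  by (simp add: dual_ball_def)

lemma dual_ball_le:
  assumes "\<phi> \<in> dual_ball"
  shows "cmod (\<phi> x) \<le> norm x"
proof -
  have "cmod (\<phi> x) \<le> norm \<phi> * norm x"
    by (rule norm_blinfun)
  also have "\<dots> \<le> 1 * norm x"
    using assms by (intro mult_right_mono) (auto simp: dual_ball_def)
  finally show ?thesis by simp
qed

text \<open>Smoothness normalizes only the real part of a functional at \<open>x\<close>; in the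
  closed unit disc this already forces the value to be 1.\<close>

lemma complex_eq_1I:
  assumes "Re z = 1" "cmod z \<le> 1"
  shows "z = 1"
proof -
  have "(Re z)\<^sup>2 + (Im z)\<^sup>2 \<le> 1"
    using assms(2) by (metis cmod_power2 norm_ge_zero power_le_one)
  then show ?thesis using assms(1) by (simp add: complex_eq_iff)
qed

lemma smooth_functional_unique:
  fixes x :: "'a::complex_normed_vector"
  assumes "smooth_space TYPE('a)" "norm x = 1"
    and "\<phi> \<in> dual_ball" "\<phi> x = 1" "\<psi> \<in> dual_ball" "\<psi> x = 1"
  shows "\<phi> = \<psi>"
  using assms unfolding smooth_space_def by (metis one_complex.simps(1))

lemma norming_functional_unit:
  fixes x :: "'a::complex_normed_vector"
  assumes "smooth_space TYPE('a)" "norm x = 1"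
  obtains \<phi> where "\<phi> \<in> dual_ball" "blinfun_apply \<phi> x = 1"
proof -
  obtain \<phi> where \<phi>: "\<phi> \<in> dual_ball" "Re (blinfun_apply \<phi> x) = 1"
    using assms unfolding smooth_space_def by blast
  then have "\<phi> x = 1"
    using dual_ball_le[OF \<phi>(1), of x] assms(2) by (intro complex_eq_1I) auto
  with \<phi>(1) show thesis by (rule that)
qed

text \<open>At \<open>v = 0\<close> every unit vector serves as direction, so later arguments need
  not treat the origin separately.\<close>

lemma unit_direction:
  fixes v :: "'a::real_normed_vector"
  assumes "\<exists>x::'a. x \<noteq> 0"
  obtains w where "norm w = 1" "v = norm v *\<^sub>R w"
proof (cases "v = 0")
  case True
  obtain x :: 'a where "x \<noteq> 0" using assms by blast
  with True show thesis by (intro that[of "sgn x"]) (simp_all add: norm_sgn)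
next
  case False
  then show thesis by (intro that[of "sgn v"]) (simp_all add: norm_sgn sgn_div_norm)
qed

lemma norming_functional:
  fixes v :: "'a::complex_normed_vector"
  assumes smooth: "smooth_space TYPE('a)" and nontrivial: "\<exists>x::'a. x \<noteq> 0"
  obtains \<phi> where "\<phi> \<in> dual_ball" "blinfun_apply \<phi> v = of_real (norm v)"
proof -
  obtain w :: 'a where w: "norm w = 1" "v = norm v *\<^sub>R w"
    using unit_direction[OF nontrivial] by blast
  obtain \<phi> where \<phi>: "\<phi> \<in> dual_ball" "blinfun_apply \<phi> w = 1"
    using norming_functional_unit[OF smooth w(1)] by blast
  have "\<phi> v = norm v *\<^sub>R \<phi> w"
    by (subst w(2)) (rule blinfun.scaleR_right)
  then show thesis
    using \<phi> by (intro that) (auto simp: scaleR_conv_of_real)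
qed

section \<open>Complex lines, Cauchy estimates and uniform limits\<close>

text \<open>Complex homogeneity of \<open>D\<close> and \<open>\<phi>\<close> makes the real
  derivative of the slice multiplication by the complex number \<open>\<phi> (D h)\<close>. This
  opens the way to one-variable complex analysis.\<close>

lemma slice_derivative:
  fixes f :: "'a::complex_normed_vector \<Rightarrow> 'a"
  assumes "(f has_derivative D) (at (x + \<zeta> *\<^sub>C h))" "\<And>c y. D (c *\<^sub>C y) = c *\<^sub>C D y"
    and "\<phi> \<in> dual_ball"
  shows "((\<lambda>\<zeta>. blinfun_apply \<phi> (f (x + \<zeta> *\<^sub>C h))) has_field_derivative \<phi> (D h)) (at \<zeta>)"
proof -
  have line: "((\<lambda>\<zeta>. x + \<zeta> *\<^sub>C h) has_derivative (\<lambda>c. c *\<^sub>C h)) (at \<zeta>)"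
    using bounded_linear_imp_has_derivative[OF
        bounded_bilinear.bounded_linear_left[OF bounded_bilinear_scaleC]]
    by (auto intro!: derivative_eq_intros)
  have "((\<lambda>\<zeta>. blinfun_apply \<phi> (f (x + \<zeta> *\<^sub>C h))) has_derivative (\<lambda>c. \<phi> (D (c *\<^sub>C h)))) (at \<zeta>)"
    using has_derivative_compose[OF line assms(1)]
    by (rule bounded_linear.has_derivative[OF blinfun.bounded_linear_right])
  moreover have "(\<lambda>c. blinfun_apply \<phi> (D (c *\<^sub>C h))) = (*) (\<phi> (D h))"
    by (auto simp: assms(2) dual_ball_scaleC[OF assms(3)] mult.commute)
  ultimately show ?thesis
    by (simp add: has_field_derivative_def)
qed

lemma slice_holomorphic:
  fixes f :: "'a::complex_normed_vector \<Rightarrow> 'a"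
  assumes "holomorphic_map_on f U" "\<phi> \<in> dual_ball"
    and "\<And>\<zeta>. \<zeta> \<in> V \<Longrightarrow> x + \<zeta> *\<^sub>C h \<in> U"
  shows "(\<lambda>\<zeta>. blinfun_apply \<phi> (f (x + \<zeta> *\<^sub>C h))) holomorphic_on V"
  unfolding holomorphic_on_def
proof
  fix \<zeta> assume "\<zeta> \<in> V"
  then obtain D where "(f has_derivative D) (at (x + \<zeta> *\<^sub>C h))" "\<And>c y. D (c *\<^sub>C y) = c *\<^sub>C D y"
    using assms unfolding holomorphic_map_on_def by blast
  from slice_derivative[OF this assms(2)]
  show "(\<lambda>\<zeta>. blinfun_apply \<phi> (f (x + \<zeta> *\<^sub>C h))) field_differentiable at \<zeta> within V"
    by (meson field_differentiable_at_within field_differentiable_def)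
qed

text \<open>A functional that norms \<open>D h\<close> reduces the claim to Cauchy's inequality for
  the scalar function \<open>\<zeta> \<mapsto> \<phi> (f (x + \<zeta> h))\<close>, whose derivative
  at 0 has modulus \<open>norm (D h)\<close>.\<close>

lemma Cauchy_estimate:
  fixes f :: "'a::complex_normed_vector \<Rightarrow> 'a"
  assumes smooth: "smooth_space TYPE('a)" and nontrivial: "\<exists>x::'a. x \<noteq> 0"
    and hol: "holomorphic_map_on f (ball x r)" and "r > 0"
    and bound: "\<And>y. y \<in> ball x r \<Longrightarrow> norm (f y) \<le> B"
    and D: "(f has_derivative D) (at x)" "\<And>c y. D (c *\<^sub>C y) = c *\<^sub>C D y"
  shows "norm (D h) \<le> 2 * B / r * norm h"
proof (cases "h = 0")
  case True
  then show ?thesis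
    using D(2)[of 0 h] by (simp add: bounded_bilinear.zero_left[OF bounded_bilinear_scaleC])
next
  case False
  obtain \<phi> where \<phi>: "\<phi> \<in> dual_ball" "blinfun_apply \<phi> (D h) = of_real (norm (D h))"
    using norming_functional[OF smooth nontrivial] by blast
  define g where "g = (\<lambda>\<zeta>. blinfun_apply \<phi> (f (x + \<zeta> *\<^sub>C h)))"
  \<comment> \<open>Half of \<open>r / norm h\<close>, so that the closed disc of radius
    \<open>\<rho>\<close> is still mapped into the open ball; this accounts for the factor 2 in the
    bound.\<close>
  define \<rho> where "\<rho> = r / (2 * norm h)"
  have \<rho>: "\<rho> > 0" using False \<open>r > 0\<close> by (simp add: \<rho>_def)
  have mem: "x + \<zeta> *\<^sub>C h \<in> ball x r" if "\<zeta> \<in> cball 0 \<rho>" for \<zeta>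
  proof -
    have "cmod \<zeta> * norm h \<le> \<rho> * norm h"
      using that by (intro mult_right_mono) auto
    also have "\<dots> < r" using False \<open>r > 0\<close> by (simp add: \<rho>_def)
    finally show ?thesis by (simp add: dist_norm norm_scaleC)
  qed
  have holg: "g holomorphic_on cball 0 \<rho>"
    unfolding g_def using mem by (rule slice_holomorphic[OF hol \<phi>(1)])
  have "norm ((deriv ^^ 1) g 0) \<le> fact 1 * B / \<rho> ^ 1"
  proof (rule Cauchy_inequality[OF _ _ \<rho>])
    show "g holomorphic_on ball 0 \<rho>"
      using holg ball_subset_cball by (rule holomorphic_on_subset)
    show "continuous_on (cball 0 \<rho>) g"
      using holg by (rule holomorphic_on_imp_continuous_on)
    fix \<zeta> :: complex assume "norm (0 - \<zeta>) = \<rho>"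
    then show "norm (g \<zeta>) \<le> B"
      unfolding g_def using dual_ball_le[OF \<phi>(1)] bound mem
      by (metis dist_norm mem_cball order_refl order_trans)
  qed
  moreover have "deriv g 0 = \<phi> (D h)"
    unfolding g_def using D \<phi>(1)
    by (intro DERIV_imp_deriv slice_derivative)
       (simp_all add: bounded_bilinear.zero_left[OF bounded_bilinear_scaleC])
  ultimately show ?thesis
    using False by (simp add: \<phi>(2) \<rho>_def field_simps)
qed

lemma holomorphic_map_on_diff:
  assumes "holomorphic_map_on f U" "holomorphic_map_on g U"
  shows "holomorphic_map_on (\<lambda>x. f x - g x) U"
  unfolding holomorphic_map_on_def
proof
  fix x assume "x \<in> U"
  then obtain D E where D: "(f has_derivative D) (at x)" "\<And>c y. D (c *\<^sub>C y) = c *\<^sub>C D y"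
    and E: "(g has_derivative E) (at x)" "\<And>c y. E (c *\<^sub>C y) = c *\<^sub>C E y"
    using assms unfolding holomorphic_map_on_def by meson
  show "\<exists>D. ((\<lambda>x. f x - g x) has_derivative D) (at x) \<and> (\<forall>c y. D (c *\<^sub>C y) = c *\<^sub>C D y)"
    using has_derivative_diff[OF D(1) E(1)]
    by (intro exI[of _ "\<lambda>h. D h - E h"])
       (simp add: D(2) E(2) bounded_bilinear.diff_right[OF bounded_bilinear_scaleC])
qed

lemma holomorphic_map_on_subset:
  "holomorphic_map_on f U \<Longrightarrow> V \<subseteq> U \<Longrightarrow> holomorphic_map_on f V"
  unfolding holomorphic_map_on_def by blast

text \<open>The Cauchy estimate for the differences \<open>f m - f n\<close> makes the derivatives
  uniformly Cauchy near each point, so the limit may be differentiated termwise. Complex homogeneity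
  passes to the limit derivative pointwise.\<close>

lemma holomorphic_uniform_limit:
  fixes f :: "nat \<Rightarrow> 'a::complex_banach \<Rightarrow> 'a"
  assumes smooth: "smooth_space TYPE('a)" and nontrivial: "\<exists>x::'a. x \<noteq> 0"
    and hol: "\<And>n. holomorphic_map_on (f n) U" and "open U"
    and lim: "uniform_limit U f g sequentially"
  shows "holomorphic_map_on g U"
  unfolding holomorphic_map_on_def
proof
  fix a assume "a \<in> U"
  then obtain r where r: "r > 0" "ball a r \<subseteq> U"
    using \<open>open U\<close> openE by blast
  obtain D where D: "\<And>n x. x \<in> U \<Longrightarrow> (f n has_derivative D n x) (at x)"
      "\<And>n x c y. x \<in> U \<Longrightarrow> D n x (c *\<^sub>C y) = c *\<^sub>C D n x y"
    using hol unfolding holomorphic_map_on_def by metis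
  \<comment> \<open>Every point of \<open>S\<close> still has a ball of radius \<open>r/2\<close>
    inside \<open>U\<close>, so one Cauchy estimate holds uniformly on \<open>S\<close>.\<close>
  define S where "S = ball a (r/2)"
  have SU: "ball x (r/2) \<subseteq> U" if "x \<in> S" for x
  proof
    fix y assume "y \<in> ball x (r/2)"
    then have "dist a y < r"
      using that dist_triangle[of a y x] by (simp add: S_def)
    then show "y \<in> U" using r(2) by auto
  qed
  have S_U: "x \<in> U" if "x \<in> S" for x
    using SU[OF that] r(1) by auto
  have diff: "norm (D m x h - D n x h) \<le> 2 * B / (r/2) * norm h"
    if "x \<in> S" "\<And>y. y \<in> U \<Longrightarrow> norm (f m y - f n y) \<le> B" for m n x h B
    using that S_U[OF that(1)] r(1) SU[OF that(1)]
    by (intro Cauchy_estimate[OF smooth nontrivial, of "\<lambda>y. f m y - f n y" x])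
       (auto intro!: holomorphic_map_on_diff holomorphic_map_on_subset[OF hol] has_derivative_diff D(1)
         simp: D(2) bounded_bilinear.diff_right[OF bounded_bilinear_scaleC])
  have Cauchy: "\<exists>N. \<forall>m\<ge>N. \<forall>n\<ge>N. \<forall>x\<in>S. \<forall>h. norm (D m x h - D n x h) \<le> e * norm h"
    if "e > 0" for e
  proof -
    \<comment> \<open>With this \<open>B\<close> the constant \<open>2 * B / (r/2)\<close> of the
      estimate equals \<open>e\<close>.\<close>
    define B where "B = e * r / 4"
    have "B > 0" using \<open>e > 0\<close> r(1) by (simp add: B_def)
    have "uniformly_Cauchy_on U f"
      using lim uniformly_convergent_eq_Cauchy uniformly_convergent_on_def by blast
    then obtain N where N: "\<And>m n y. m \<ge> N \<Longrightarrow> n \<ge> N \<Longrightarrow> y \<in> U \<Longrightarrow> dist (f m y) (f n y) < B"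
      using \<open>B > 0\<close> unfolding uniformly_Cauchy_on_def by meson
    have "norm (D m x h - D n x h) \<le> e * norm h" if "m \<ge> N" "n \<ge> N" "x \<in> S" for m n x h
      using diff[OF \<open>x \<in> S\<close>, of m n B h] N[OF that(1,2)] r(1)
      by (simp add: dist_norm less_imp_le B_def)
    then show ?thesis by blast
  qed
  have "\<exists>l. (\<lambda>n. D n x h) \<longlonglongrightarrow> l" if "x \<in> S" for x h
  proof (rule Cauchy_convergent[unfolded convergent_def])
    show "Cauchy (\<lambda>n. D n x h)"
    proof (rule metric_CauchyI)
      fix e :: real assume "e > 0"
      define e' where "e' = e / (norm h + 1)"
      have "e' > 0" using \<open>e > 0\<close> by (simp add: e'_def add_nonneg_pos)
      have "e' * norm h < e"
        using \<open>e > 0\<close> by (simp add: e'_def pos_divide_less_eq add_nonneg_pos mult_strict_left_mono)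
      moreover obtain N where "\<forall>m\<ge>N. \<forall>n\<ge>N. \<forall>x\<in>S. \<forall>h. norm (D m x h - D n x h) \<le> e' * norm h"
        using Cauchy[OF \<open>e' > 0\<close>] by blast
      then have "dist (D m x h) (D n x h) \<le> e' * norm h" if "m \<ge> N" "n \<ge> N" for m n
        using that \<open>x \<in> S\<close> by (simp add: dist_norm)
      ultimately have "dist (D m x h) (D n x h) < e" if "m \<ge> N" "n \<ge> N" for m n
        using that by (meson le_less_trans)
      then show "\<exists>N. \<forall>m\<ge>N. \<forall>n\<ge>N. dist (D m x h) (D n x h) < e"
        by blast
    qed
  qed
  then obtain G where G: "\<And>x h. x \<in> S \<Longrightarrow> (\<lambda>n. D n x h) \<longlonglongrightarrow> G x h"
    by metis
  have aS: "a \<in> S" using r(1) by (simp add: S_def)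
  have "\<exists>k. \<forall>x\<in>S. (\<lambda>n. f n x) \<longlonglongrightarrow> k x \<and> (k has_derivative G x) (at x within S)"
  proof (rule has_derivative_sequence)
    show "convex S" by (simp add: S_def)
    show "(f n has_derivative D n x) (at x within S)" if "x \<in> S" for n x
      using D(1)[OF S_U[OF that]] by (rule has_derivative_at_withinI)
    show "(\<lambda>n. f n a) \<longlonglongrightarrow> g a"
      using lim \<open>a \<in> U\<close> by (rule tendsto_uniform_limitI)
    fix e :: real assume "e > 0"
    from Cauchy[OF this] obtain N
      where N: "\<forall>m\<ge>N. \<forall>n\<ge>N. \<forall>x\<in>S. \<forall>h. norm (D m x h - D n x h) \<le> e * norm h" by blast
    have "norm (D n x h - G x h) \<le> e * norm h" if "n \<ge> N" "x \<in> S" for n x h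
    proof (rule tendsto_upperbound)
      show "(\<lambda>m. norm (D n x h - D m x h)) \<longlonglongrightarrow> norm (D n x h - G x h)"
        using G[OF that(2)] by (intro tendsto_intros)
      show "\<forall>\<^sub>F m in sequentially. norm (D n x h - D m x h) \<le> e * norm h"
        by (rule eventually_sequentiallyI[of N]) (use N that in simp)
    qed simp
    then show "\<forall>\<^sub>F n in sequentially. \<forall>x\<in>S. \<forall>h. norm (D n x h - G x h) \<le> e * norm h"
      by (intro eventually_sequentiallyI[of N]) simp
  qed (rule aS)
  then obtain k where k: "\<And>x. x \<in> S \<Longrightarrow> (\<lambda>n. f n x) \<longlonglongrightarrow> k x"
    "\<And>x. x \<in> S \<Longrightarrow> (k has_derivative G x) (at x within S)" by blast
  \<comment> \<open>Termwise differentiation yields a limit function \<open>k\<close> of its own,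
    which has to be identified with \<open>g\<close> on \<open>S\<close>.\<close>
  have kg: "k x = g x" if "x \<in> S" for x
    using k(1)[OF that] tendsto_uniform_limitI[OF lim S_U[OF that]] by (rule LIMSEQ_unique)
  have "open S" by (simp add: S_def)
  then have "(k has_derivative G a) (at a)"
    using k(2)[OF aS] at_within_open[OF aS] by simp
  then have "(g has_derivative G a) (at a)"
    using \<open>open S\<close> aS kg by (rule has_derivative_transform_within_open)
  moreover have "G a (c *\<^sub>C y) = c *\<^sub>C G a y" for c y
  proof (rule LIMSEQ_unique)
    show "(\<lambda>n. D n a (c *\<^sub>C y)) \<longlonglongrightarrow> G a (c *\<^sub>C y)" using G[OF aS] .
    show "(\<lambda>n. D n a (c *\<^sub>C y)) \<longlonglongrightarrow> c *\<^sub>C G a y"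
      unfolding D(2)[OF \<open>a \<in> U\<close>]
      by (intro bounded_bilinear.tendsto[OF bounded_bilinear_scaleC] tendsto_const G[OF aS])
  qed
  ultimately show "\<exists>D. (g has_derivative D) (at a) \<and> (\<forall>c y. D (c *\<^sub>C y) = c *\<^sub>C D y)"
    by blast
qed

section \<open>The space of functions\<close>

lemma Au_dist_le:
  fixes f g :: "'a::complex_normed_vector \<Rightarrow> 'a"
  assumes "f \<in> Au" "g \<in> Au" "x \<in> cball 0 1"
  shows "norm (f x - g x) \<le> mdist Au_metric f g"
proof -
  obtain B C where "\<forall>y\<in>f ` cball 0 1. norm y \<le> B" "\<forall>y\<in>g ` cball 0 1. norm y \<le> C"
    using assms unfolding Au_def bounded_iff by auto
  then have B: "\<And>y. y \<in> cball 0 1 \<Longrightarrow> norm (f y) \<le> B"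
    and C: "\<And>y. y \<in> cball 0 1 \<Longrightarrow> norm (g y) \<le> C" by simp_all
  have "bdd_above ((\<lambda>x. norm (f x - g x)) ` cball 0 1)"
    by (rule bdd_aboveI2[of _ _ "B + C"]) (intro order_trans[OF norm_triangle_ineq4] add_mono B C)
  then show ?thesis
    unfolding mdist_Au[OF assms(1,2)] Au_norm_def using assms(3) by (intro cSUP_upper)
qed

lemma Au_dist_least:
  fixes f g :: "'a::complex_normed_vector \<Rightarrow> 'a"
  assumes "f \<in> Au" "g \<in> Au" "\<And>x. x \<in> cball 0 1 \<Longrightarrow> norm (f x - g x) \<le> e"
  shows "mdist Au_metric f g \<le> e"
  unfolding mdist_Au[OF assms(1,2)] Au_norm_def using assms(3) by (intro cSUP_least) auto

text \<open>Members of \<open>Au\<close> are \<open>undefined\<close> off the closed ball, so a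
  function given by a formula has to be cut down first. Near an interior point the restriction
  agrees with \<open>g\<close>, hence has the same derivative.\<close>

lemma Au_restrictI:
  fixes g :: "'a::complex_normed_vector \<Rightarrow> 'a"
  assumes "bounded (g ` cball 0 1)" "uniformly_continuous_on (cball 0 1) g"
    and hol: "holomorphic_map_on g (interior (cball 0 1))"
  shows "restrict g (cball 0 1) \<in> Au"
proof -
  have "holomorphic_map_on (restrict g (cball 0 1)) (interior (cball 0 1))"
    unfolding holomorphic_map_on_def
  proof
    fix x :: 'a assume x: "x \<in> interior (cball 0 1)"
    obtain D where D: "(g has_derivative D) (at x)" "\<forall>c y. D (c *\<^sub>C y) = c *\<^sub>C D y"
      using hol x unfolding holomorphic_map_on_def by blast
    have "(restrict g (cball 0 1) has_derivative D) (at x)"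
      using interior_subset[of "cball (0::'a) 1"]
      by (intro has_derivative_transform_within_open[OF D(1) open_interior x]) auto
    with D(2) show "\<exists>D. (restrict g (cball 0 1) has_derivative D) (at x)
        \<and> (\<forall>c y. D (c *\<^sub>C y) = c *\<^sub>C D y)" by blast
  qed
  moreover have "uniformly_continuous_on (cball 0 1) (restrict g (cball 0 1))"
    using assms(2) by (simp add: uniformly_continuous_on_def)
  ultimately show ?thesis
    using assms(1) by (simp add: Au_def)
qed

lemma uniformly_continuous_on_subset:
  fixes f :: "'a::metric_space \<Rightarrow> 'b::metric_space"
  assumes "uniformly_continuous_on T f" "S \<subseteq> T"
  shows "uniformly_continuous_on S f"
  unfolding uniformly_continuous_on_def
proof (intro allI impI)
  fix e :: real assume "e > 0"
  then obtain d where "d > 0" and d: "\<forall>x\<in>T. \<forall>y\<in>T. dist y x < d \<longrightarrow> dist (f y) (f x) < e"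
    using assms(1) unfolding uniformly_continuous_on_def by blast
  then show "\<exists>d>0. \<forall>x\<in>S. \<forall>y\<in>S. dist y x < d \<longrightarrow> dist (f y) (f x) < e"
    using assms(2) by (intro exI[of _ d]) (simp add: subset_iff)
qed

text \<open>Admits the perturbations of the density argument. The unit ball of \<open>X\<close> need
  not be compact, but \<open>\<phi>\<close> maps it into the closed unit disc, where the entire
  function \<open>p\<close> is bounded and uniformly continuous.\<close>

lemma Au_add_ridge:
  fixes f :: "'a::complex_normed_vector \<Rightarrow> 'a"
  assumes f: "f \<in> Au" and \<phi>: "\<phi> \<in> dual_ball" and p: "p holomorphic_on UNIV"
  shows "restrict (\<lambda>y. f y + p (blinfun_apply \<phi> y) *\<^sub>C u) (cball 0 1) \<in> Au"
proof (rule Au_restrictI)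
  have scale: "bounded_linear (\<lambda>c. c *\<^sub>C u)"
    by (rule bounded_bilinear.bounded_linear_left[OF bounded_bilinear_scaleC])
  have cont: "continuous_on (cball 0 1) p"
    using p by (intro holomorphic_on_imp_continuous_on) (rule holomorphic_on_subset, auto)
  have maps: "blinfun_apply \<phi> ` cball 0 1 \<subseteq> cball 0 1"
    by (auto intro: order_trans[OF dual_ball_le[OF \<phi>]])
  have "bounded ((\<lambda>c. p c *\<^sub>C u) ` cball 0 1)"
    by (intro compact_imp_bounded compact_continuous_image
        bounded_linear.continuous_on[OF scale] cont compact_cball)
  then have "bounded ((\<lambda>y. p (blinfun_apply \<phi> y) *\<^sub>C u) ` cball 0 1)"
    by (rule bounded_subset) (use maps in auto)
  then show "bounded ((\<lambda>y. f y + p (blinfun_apply \<phi> y) *\<^sub>C u) ` cball 0 1)"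
    using f by (intro bounded_plus_comp) (auto simp: Au_def)
  have "uniformly_continuous_on (blinfun_apply \<phi> ` cball 0 1) p"
    using maps by (rule uniformly_continuous_on_subset[OF compact_uniformly_continuous[OF cont compact_cball]])
  then have "uniformly_continuous_on (cball 0 1) (\<lambda>y. p (blinfun_apply \<phi> y))"
    by (rule uniformly_continuous_on_compose[OF bounded_linear.uniformly_continuous_on[OF
            blinfun.bounded_linear_right uniformly_continuous_on_id]])
  then show "uniformly_continuous_on (cball 0 1) (\<lambda>y. f y + p (blinfun_apply \<phi> y) *\<^sub>C u)"
    using f unfolding Au_def
    by (auto intro: uniformly_continuous_on_add[OF _ bounded_linear.uniformly_continuous_on[OF scale]])
  show "holomorphic_map_on (\<lambda>y. f y + p (blinfun_apply \<phi> y) *\<^sub>C u) (interior (cball 0 1))"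
    unfolding holomorphic_map_on_def
  proof
    fix x :: 'a assume "x \<in> interior (cball 0 1)"
    then obtain D where D: "(f has_derivative D) (at x)" "\<And>c y. D (c *\<^sub>C y) = c *\<^sub>C D y"
      using f unfolding Au_def holomorphic_map_on_def by auto
    obtain q where "(p has_field_derivative q) (at (\<phi> x))"
      using p by (auto simp: holomorphic_on_def field_differentiable_def)
    then have "(p has_derivative (*) q) (at (\<phi> x))"
      by (simp add: has_field_derivative_def)
    with bounded_linear_imp_has_derivative[OF blinfun.bounded_linear_right]
    have "((\<lambda>y. p (blinfun_apply \<phi> y)) has_derivative (\<lambda>h. q * \<phi> h)) (at x)"
      by (rule has_derivative_compose)
    then have "((\<lambda>y. f y + p (blinfun_apply \<phi> y) *\<^sub>C u)
        has_derivative (\<lambda>h. D h + (q * \<phi> h) *\<^sub>C u)) (at x)"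
      by (intro has_derivative_add D(1) bounded_linear.has_derivative[OF scale])
    moreover have "D (c *\<^sub>C y) + (q * \<phi> (c *\<^sub>C y)) *\<^sub>C u = c *\<^sub>C (D y + (q * \<phi> y) *\<^sub>C u)" for c y
      by (simp add: D(2) dual_ball_scaleC[OF \<phi>] scaleC_add_right scaleC_scaleC mult.left_commute)
    ultimately show "\<exists>D. ((\<lambda>y. f y + p (blinfun_apply \<phi> y) *\<^sub>C u) has_derivative D) (at x)
        \<and> (\<forall>c y. D (c *\<^sub>C y) = c *\<^sub>C D y)"
      by blast
  qed
qed

section \<open>Completeness of the function space\<close>

lemma Metric_space_Au: "Metric_space Au (mdist Au_metric)"
  using Metric_space_mspace_mdist[of Au_metric] by simp

lemma mtopology_Au: "Au_topology = Metric_space.mtopology Au (mdist Au_metric)"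
  by (simp add: mtopology_of_def)

text \<open>Prepares the use of Baire's theorem. Boundedness and uniform continuity pass to uniform
  limits in the usual way; holomorphy passes by the Cauchy estimates.\<close>

lemma mcomplete_Au:
  assumes smooth: "smooth_space TYPE('a::complex_banach)" and nontrivial: "\<exists>x::'a. x \<noteq> 0"
  shows "Metric_space.mcomplete (Au :: ('a \<Rightarrow> 'a) set) (mdist Au_metric)"
proof -
  interpret Metric_space "Au :: ('a \<Rightarrow> 'a) set" "mdist Au_metric"
    by (rule Metric_space_Au)
  show ?thesis
    unfolding mcomplete_def
  proof (intro allI impI)
    fix \<sigma> :: "nat \<Rightarrow> 'a \<Rightarrow> 'a" assume "MCauchy \<sigma>"
    then have \<sigma>: "\<And>n. \<sigma> n \<in> Au"
      and Cauchy: "\<And>e. e > 0 \<Longrightarrow> \<exists>N. \<forall>m n. N \<le> m \<longrightarrow> N \<le> n \<longrightarrow> mdist Au_metric (\<sigma> m) (\<sigma> n) < e"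
      by (auto simp: MCauchy_def)
    have "uniformly_Cauchy_on (cball 0 1) \<sigma>"
      unfolding uniformly_Cauchy_on_def
    proof (intro allI impI)
      fix e :: real assume "e > 0"
      from Cauchy[OF this] obtain N where
        N: "\<And>m n. N \<le> m \<Longrightarrow> N \<le> n \<Longrightarrow> mdist Au_metric (\<sigma> m) (\<sigma> n) < e" by blast
      have "dist (\<sigma> m x) (\<sigma> n x) < e" if "x \<in> cball 0 1" "N \<le> m" "N \<le> n" for m n x
        using Au_dist_le[OF \<sigma> \<sigma> that(1), of m n] N[OF that(2,3)] by (simp add: dist_norm)
      then show "\<exists>N. \<forall>x\<in>cball 0 1. \<forall>m\<ge>N. \<forall>n\<ge>N. dist (\<sigma> m x) (\<sigma> n x) < e" by blast
    qed
    then obtain g where g: "uniform_limit (cball 0 1) \<sigma> g sequentially"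
      using Cauchy_uniformly_convergent unfolding uniformly_convergent_on_def by blast
    \<comment> \<open>The uniform limit is determined only on the ball; the restriction is the
      representative that can lie in \<open>Au\<close>.\<close>
    define h where "h = restrict g (cball 0 1)"
    have close: "\<exists>N. \<forall>n\<ge>N. \<forall>x\<in>cball 0 1. dist (\<sigma> n x) (g x) < e" if "e > 0" for e
      using g that by (simp add: uniform_limit_sequentially_iff)
    have h: "h \<in> Au"
      unfolding h_def
    proof (rule Au_restrictI)
      have bdd: "\<And>n. bounded (\<sigma> n ` cball 0 1)" using \<sigma> by (auto simp: Au_def)
      then show "bounded (g ` cball 0 1)"
        using g by (intro uniform_limit_bounded[where f = \<sigma>]) auto
      show "uniformly_continuous_on (cball 0 1) g"
        unfolding uniformly_continuous_on_def
      proof (intro allI impI)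
        fix e :: real assume "e > 0"
        then obtain n where n: "\<And>x. x \<in> cball 0 1 \<Longrightarrow> dist (\<sigma> n x) (g x) < e/3"
          using close[of "e/3"] by (meson order_refl divide_pos_pos zero_less_numeral)
        have "uniformly_continuous_on (cball 0 1) (\<sigma> n)" using \<sigma> by (auto simp: Au_def)
        moreover have "e/3 > 0" using \<open>e > 0\<close> by simp
        ultimately obtain d where d: "d > 0"
          "\<And>x y. x \<in> cball 0 1 \<Longrightarrow> y \<in> cball 0 1 \<Longrightarrow> dist y x < d \<Longrightarrow> dist (\<sigma> n y) (\<sigma> n x) < e/3"
          unfolding uniformly_continuous_on_def by meson
        have "dist (g y) (g x) < e"
          if "x \<in> cball 0 1" "y \<in> cball 0 1" "dist y x < d" for x y
        proof -
          have "dist (g y) (g x) \<le> dist (g y) (\<sigma> n y) + dist (\<sigma> n y) (\<sigma> n x) + dist (\<sigma> n x) (g x)"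
            using dist_triangle[of "g y" "g x" "\<sigma> n x"] dist_triangle[of "g y" "\<sigma> n x" "\<sigma> n y"]
            by linarith
          then show ?thesis
            using n[OF that(1)] n[OF that(2)] d(2)[OF that] by (simp add: dist_commute)
        qed
        with d(1) show "\<exists>d>0. \<forall>x\<in>cball 0 1. \<forall>y\<in>cball 0 1. dist y x < d \<longrightarrow> dist (g y) (g x) < e"
          by blast
      qed
      show "holomorphic_map_on g (interior (cball 0 1))"
      proof (rule holomorphic_uniform_limit[OF smooth nontrivial])
        show "holomorphic_map_on (\<sigma> n) (interior (cball 0 1))" for n using \<sigma> by (auto simp: Au_def)
        show "uniform_limit (interior (cball 0 1)) \<sigma> g sequentially"
          using g interior_subset by (rule uniform_limit_on_subset)
      qed (rule open_interior)
    qed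
    have "limitin mtopology \<sigma> h sequentially"
      unfolding limitin_metric
    proof (intro conjI allI impI h)
      fix e :: real assume "e > 0"
      \<comment> \<open>A supremum of distances below \<open>e/2\<close> is at most
        \<open>e/2\<close>, hence strictly below \<open>e\<close>.\<close>
      then obtain N where N: "\<And>n x. n \<ge> N \<Longrightarrow> x \<in> cball 0 1 \<Longrightarrow> dist (\<sigma> n x) (g x) < e/2"
        using close[of "e/2"] by (meson half_gt_zero)
      have "mdist Au_metric (\<sigma> n) h \<le> e/2" if "n \<ge> N" for n
        using N[OF that] by (intro Au_dist_least \<sigma> h) (auto simp: h_def dist_norm less_imp_le)
      then have "\<forall>n\<ge>N. mdist Au_metric (\<sigma> n) h < e"
        using \<open>e > 0\<close> by fastforce
      then show "\<forall>\<^sub>F n in sequentially. \<sigma> n \<in> Au \<and> mdist Au_metric (\<sigma> n) h < e"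
        using \<sigma> unfolding eventually_sequentially by blast
    qed
    then show "\<exists>h. limitin mtopology \<sigma> h sequentially" by blast
  qed
qed

section \<open>Continuity of the duality map\<close>

text \<open>
  A cluster point of the functionals in a product of discs is again a support functional at \<open>x\<close>.
\<close>

lemma duality_map_continuous:
  fixes x :: "'a::complex_normed_vector" and \<phi>s :: "nat \<Rightarrow> 'a \<Rightarrow>\<^sub>L complex"
  assumes smooth: "smooth_space TYPE('a)" and x: "norm x = 1"
    and \<phi>: "\<phi> \<in> dual_ball" "\<phi> x = 1"
    and \<phi>s: "\<And>n. \<phi>s n \<in> dual_ball" "\<And>n. \<phi>s n (xs n) = 1"
    and lim: "xs \<longlonglongrightarrow> x"
  shows "(\<lambda>n. \<phi>s n y) \<longlonglongrightarrow> \<phi> y"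
proof (rule ccontr)
  assume "\<not> ?thesis"
  then obtain e where e: "e > 0" "\<not> (\<forall>\<^sub>F n in sequentially. dist (\<phi>s n y) (\<phi> y) < e)"
    unfolding tendsto_iff by blast
  \<comment> \<open>Infinitely many \<open>\<phi>s n y\<close> stay at distance at least
    \<open>e\<close> from \<open>\<phi> y\<close>; \<open>F\<close> is the filter of functionals
    along exactly these indices and therefore proper.\<close>
  define F where "F = filtermap (\<lambda>n. blinfun_apply (\<phi>s n))
    (inf sequentially (principal {n. e \<le> dist (\<phi>s n y) (\<phi> y)}))"
  have ev_F: "eventually P F"
    if "\<forall>\<^sub>F n in sequentially. e \<le> dist (\<phi>s n y) (\<phi> y) \<longrightarrow> P (blinfun_apply (\<phi>s n))" for P
    using that by (simp add: F_def eventually_filtermap eventually_inf_principal)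
  have "F \<noteq> bot"
    using e(2) by (simp add: F_def filtermap_bot_iff, simp add: trivial_limit_def eventually_inf_principal not_le)
  \<comment> \<open>Compact by Tychonoff's theorem; functionals in the dual ball lie in it because
    \<open>cmod (\<phi> v) \<le> norm v\<close>.\<close>
  define K where "K = (PiE UNIV (\<lambda>v::'a. cball 0 (norm v) :: complex set))"
  have "compact K"
    using compactin_PiE[of "\<lambda>_. euclidean" UNIV "\<lambda>v::'a. cball 0 (norm v) :: complex set"]
    by (simp add: K_def euclidean_product_topology)
  moreover have "eventually (\<lambda>p. p \<in> K) F"
    by (rule ev_F) (simp add: K_def PiE_iff dual_ball_le[OF \<phi>s(1)])
  ultimately obtain g where "g \<in> K" and G_ne: "inf (nhds g) F \<noteq> bot"
    using \<open>F \<noteq> bot\<close> unfolding compact_filter by blast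
  \<comment> \<open>\<open>G\<close> refines \<open>F\<close> and converges pointwise to the cluster
    point \<open>g\<close>, so identities shared by all \<open>\<phi>s n\<close> carry over to
    \<open>g\<close>.\<close>
  define G where "G = inf (nhds g) F"
  have ne: "\<not> trivial_limit G" using G_ne by (simp add: G_def)
  have ev: "eventually P G"
    if "\<forall>\<^sub>F n in sequentially. e \<le> dist (\<phi>s n y) (\<phi> y) \<longrightarrow> P (blinfun_apply (\<phi>s n))" for P
    using ev_F[OF that] by (rule filter_leD[rotated]) (simp add: G_def)
  have eval: "((\<lambda>p. p v) \<longlongrightarrow> g v) G" for v
  proof -
    have "((\<lambda>p::'a \<Rightarrow> complex. p v) \<longlongrightarrow> g v) (at g)"
      using continuous_on_product_coordinates[where i = v and 'b = complex] by (simp add: continuous_on_def)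
    then have "((\<lambda>p::'a \<Rightarrow> complex. p v) \<longlongrightarrow> g v) (nhds g)"
      by (rule tendsto_at_iff_tendsto_nhds[of "\<lambda>p. p v" g, THEN iffD1])
    then show ?thesis
      by (rule tendsto_mono[rotated]) (simp add: G_def)
  qed
  have add: "g (v + w) = g v + g w" for v w
  proof (rule tendsto_unique[OF ne eval])
    have "\<forall>\<^sub>F p in G. p v + p w = p (v + w)"
      by (rule ev) (simp add: blinfun.add_right)
    then show "((\<lambda>p. p (v + w)) \<longlongrightarrow> g v + g w) G"
      using tendsto_add[OF eval eval] by (rule tendsto_cong[THEN iffD1])
  qed
  have scale: "g (c *\<^sub>C v) = c * g v" for c v
  proof (rule tendsto_unique[OF ne eval])
    have "\<forall>\<^sub>F p in G. c * p v = p (c *\<^sub>C v)"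
      by (rule ev) (simp add: dual_ball_scaleC[OF \<phi>s(1)])
    then show "((\<lambda>p. p (c *\<^sub>C v)) \<longlongrightarrow> c * g v) G"
      using tendsto_mult[OF tendsto_const eval] by (rule tendsto_cong[THEN iffD1])
  qed
  have g_le: "cmod (g v) \<le> norm v" for v
    using \<open>g \<in> K\<close> by (auto simp: K_def PiE_iff)
  have "bounded_linear g"
    by (rule bounded_linear_intro[where K = 1])
       (simp_all add: add g_le scaleR_scaleC scale scaleC_complex_def)
  then have app: "blinfun_apply (Blinfun g) = g" by (rule bounded_linear_Blinfun_apply)
  have ball: "Blinfun g \<in> dual_ball"
    by (auto simp: dual_ball_def app scale intro!: norm_blinfun_bound g_le)
  have "((\<lambda>p. p x) \<longlongrightarrow> 1) G"
  proof (rule tendstoI)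
    fix d :: real assume "d > 0"
    \<comment> \<open>Since \<open>\<phi>s n (xs n) = 1\<close>, the left side is the modulus of
      \<open>\<phi>s n (x - xs n)\<close>.\<close>
    have "dist (\<phi>s n x) 1 \<le> dist (xs n) x" for n
      using dual_ball_le[OF \<phi>s(1), of n "x - xs n"] \<phi>s(2)[of n]
      by (simp add: dist_norm blinfun.diff_right norm_minus_commute)
    then have "\<forall>\<^sub>F n in sequentially. dist (\<phi>s n x) 1 < d"
      using tendstoD[OF lim \<open>d > 0\<close>] by (auto elim!: eventually_mono intro: le_less_trans)
    then show "\<forall>\<^sub>F p in G. dist (p x) 1 < d"
      by (intro ev) (auto elim: eventually_mono)
  qed
  then have "g x = 1"
    by (rule tendsto_unique[OF ne eval])
  then have "Blinfun g = \<phi>"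
    by (intro smooth_functional_unique[OF smooth x]) (simp_all add: app ball \<phi>)
  \<comment> \<open>All functionals along \<open>F\<close> are \<open>e\<close>-far from
    \<open>\<phi>\<close> at \<open>y\<close>, and this closed condition survives in the limit
    \<open>g\<close>, contradicting \<open>g = \<phi>\<close>.\<close>
  moreover have "e \<le> dist (g y) (\<phi> y)"
    by (rule tendsto_lowerbound[OF tendsto_dist[OF eval tendsto_const] _ ne]) (rule ev, simp)
  ultimately show False
    using e(1) app by auto
qed

section \<open>Maximization on the ball\<close>

text \<open>Since \<open>cmod (1 + \<phi> y) = cmod (\<phi> (x + y)) \<le> norm (x + y)\<close>,
  points at which the left side tends to 2 converge to \<open>x\<close> by local uniform convexity.
  Off a ball around \<open>x\<close> the base of the power is thus bounded by some
  \<open>q < 1\<close>.\<close>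

lemma peak_power_small:
  fixes x :: "'a::complex_normed_vector"
  assumes luc: "locally_uniformly_convex TYPE('a)" and x: "norm x = 1"
    and \<phi>: "\<phi> \<in> dual_ball" "\<phi> x = 1" and "r > 0"
  obtains N where "\<And>y. y \<in> cball 0 1 \<Longrightarrow> r \<le> dist y x \<Longrightarrow> cmod (((1 + \<phi> y) / 2) ^ N) \<le> 1/2"
proof -
  have "\<exists>n. \<forall>y\<in>cball 0 1. r \<le> dist y x \<longrightarrow> cmod (1 + \<phi> y) \<le> 2 - inverse (real (Suc n))"
  proof (rule ccontr)
    assume "\<not> ?thesis"
    then have "\<forall>n. \<exists>y\<in>cball 0 1. r \<le> dist y x \<and> 2 - inverse (real (Suc n)) < cmod (1 + \<phi> y)"
      by (simp add: not_le)
    then obtain s where s: "\<And>n. s n \<in> cball 0 1" "\<And>n. r \<le> dist (s n) x"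
      "\<And>n. 2 - inverse (real (Suc n)) < cmod (1 + \<phi> (s n))"
      by metis
    have "cmod (1 + \<phi> (s n)) \<le> norm (s n + x)" for n
      using dual_ball_le[OF \<phi>(1), of "s n + x"] by (simp add: blinfun.add_right \<phi>(2) add.commute)
    then have lower: "2 - inverse (real (Suc n)) \<le> norm (s n + x)" for n
      using s(3)[of n] by (meson less_imp_le less_le_trans)
    have upper: "norm (s n + x) \<le> 2" for n
      using norm_triangle_ineq[of "s n" x] s(1)[of n] x by simp
    have "(\<lambda>n. norm (s n + x)) \<longlonglongrightarrow> 2"
    proof (rule tendsto_sandwich)
      show "(\<lambda>n. 2 - inverse (real (Suc n))) \<longlonglongrightarrow> 2"
        using tendsto_diff[OF tendsto_const LIMSEQ_inverse_real_of_nat, of 2] by simp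
      show "(\<lambda>n. 2::real) \<longlonglongrightarrow> 2" by simp
    qed (use lower upper in auto)
    then have "s \<longlonglongrightarrow> x"
      using luc s(1) x unfolding locally_uniformly_convex_def by simp
    then have "\<forall>\<^sub>F n in sequentially. dist (s n) x < r"
      using \<open>r > 0\<close> by (rule tendstoD)
    then show False
      using s(2) by (simp add: eventually_sequentially not_less) (meson order_refl not_less)
  qed
  then obtain n where
    n: "\<And>y. y \<in> cball 0 1 \<Longrightarrow> r \<le> dist y x \<Longrightarrow> cmod (1 + \<phi> y) \<le> 2 - inverse (real (Suc n))"
    by blast
  define q where "q = 1 - inverse (real (Suc n)) / 2"
  have "inverse (real (Suc n)) \<le> 1" by (simp add: field_simps)
  moreover have "0 < inverse (real (Suc n))" by simp
  ultimately have q: "0 \<le> q" "q < 1" unfolding q_def by linarith+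
  obtain N where N: "q ^ N < 1/2"
    using real_arch_pow_inv[of "1/2" q] q by auto
  have "cmod (((1 + \<phi> y) / 2) ^ N) \<le> 1/2" if "y \<in> cball 0 1" "r \<le> dist y x" for y
  proof -
    have "cmod ((1 + \<phi> y) / 2) \<le> q"
      using n[OF that] by (simp add: q_def norm_divide)
    then have "cmod ((1 + \<phi> y) / 2) ^ N \<le> q ^ N"
      by (rule power_mono) simp
    then show ?thesis using N unfolding norm_power by linarith
  qed
  then show thesis by (rule that)
qed

section \<open>Near maximizers and maximizing sequences\<close>

text \<open>Stated with one level strictly below the supremum rather than with sequences: such a
  condition survives small perturbations of \<open>F\<close> and does not presuppose that the
  supremum is attained.\<close>

definition near_maximizers_close ::
    "'i set \<Rightarrow> ('i \<Rightarrow> 'a::metric_space) \<Rightarrow> ('i \<Rightarrow> real) \<Rightarrow> real \<Rightarrow> bool" where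
  "near_maximizers_close D \<pi> F e \<longleftrightarrow>
     (\<exists>c < (SUP p\<in>D. F p). \<forall>p\<in>D. \<forall>q\<in>D. c < F p \<longrightarrow> c < F q \<longrightarrow> dist (\<pi> p) (\<pi> q) < e)"

text \<open>The predicate \<open>P\<close> permits a side condition on the sequence, such as staying
  away from a candidate limit.\<close>

lemma maximizing_sequence:
  fixes F :: "'i \<Rightarrow> real"
  assumes "D \<noteq> {}" "bdd_above (F ` D)"
    and P: "\<And>c. c < (SUP p\<in>D. F p) \<Longrightarrow> \<exists>p\<in>D. c < F p \<and> P p"
  obtains a :: "nat \<Rightarrow> 'i" where "\<And>k. a k \<in> D" "\<And>k. P (a k)" "(\<lambda>k. F (a k)) \<longlonglongrightarrow> (SUP p\<in>D. F p)"
proof -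
  define M where "M = (SUP p\<in>D. F p)"
  have "\<exists>p\<in>D. M - inverse (real (Suc k)) < F p \<and> P p" for k
    using P[of "M - inverse (real (Suc k))"] by (simp add: M_def)
  then obtain a where a: "\<And>k. a k \<in> D" "\<And>k. M - inverse (real (Suc k)) < F (a k)" "\<And>k. P (a k)"
    by metis
  have "(\<lambda>k. F (a k)) \<longlonglongrightarrow> M"
  proof (rule tendsto_sandwich)
    show "(\<lambda>k. M - inverse (real (Suc k))) \<longlonglongrightarrow> M"
      using tendsto_diff[OF tendsto_const LIMSEQ_inverse_real_of_nat, of M] by simp
    show "(\<lambda>k. M) \<longlonglongrightarrow> M" by simp
    show "\<forall>\<^sub>F k in sequentially. M - inverse (real (Suc k)) \<le> F (a k)"
      using a(2) by (simp add: less_imp_le)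
    show "\<forall>\<^sub>F k in sequentially. F (a k) \<le> M"
      unfolding M_def using a(1) assms(2) by (intro always_eventually allI cSUP_upper)
  qed
  then show thesis using a by (intro that) (auto simp: M_def)
qed

text \<open>If closeness fails for \<open>e\<close>, then above every level there are two points
  whose images are \<open>e\<close> apart, and one image is at least \<open>e/2\<close> from
  \<open>t\<close>; a maximizing sequence of such points cannot converge to \<open>t\<close>.
  Conversely, closeness makes maximizing sequences Cauchy, with a common limit by
  completeness.\<close>

lemma maximizing_sequences_converge_iff:
  fixes \<pi> :: "'i \<Rightarrow> 'a::complete_space" and F :: "'i \<Rightarrow> real"
  assumes ne: "D \<noteq> {}" and bdd: "bdd_above (F ` D)"
  shows "(\<exists>t. \<forall>s::nat \<Rightarrow> 'i. (\<forall>k. s k \<in> D) \<and> (\<lambda>k. F (s k)) \<longlonglongrightarrow> (SUP p\<in>D. F p)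
            \<longrightarrow> (\<lambda>k. \<pi> (s k)) \<longlonglongrightarrow> t) \<longleftrightarrow>
         (\<forall>n. near_maximizers_close D \<pi> F (inverse (real (Suc n))))"
    (is "(\<exists>t. \<forall>s. ?max s \<longrightarrow> ?conv s t) \<longleftrightarrow> ?R")
proof
  define M where "M = (SUP p\<in>D. F p)"
  assume "\<exists>t. \<forall>s. ?max s \<longrightarrow> ?conv s t"
  then obtain t where t: "\<And>s. (\<And>k. s k \<in> D) \<Longrightarrow> (\<lambda>k. F (s k)) \<longlonglongrightarrow> M \<Longrightarrow> ?conv s t"
    unfolding M_def by blast
  show ?R
  proof (rule ccontr)
    assume "\<not> ?R"
    then obtain e where "e > 0" and "\<not> near_maximizers_close D \<pi> F e"
      by (metis inverse_positive_iff_positive of_nat_0_less_iff zero_less_Suc)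
    have far: "\<exists>p\<in>D. c < F p \<and> e/2 \<le> dist (\<pi> p) t" if c: "c < (SUP p\<in>D. F p)" for c
    proof -
      obtain p q where pq: "p \<in> D" "q \<in> D" "c < F p" "c < F q" "e \<le> dist (\<pi> p) (\<pi> q)"
        using \<open>\<not> near_maximizers_close D \<pi> F e\<close> c
        unfolding near_maximizers_close_def by (meson not_less)
      have "dist (\<pi> p) (\<pi> q) \<le> dist (\<pi> p) t + dist (\<pi> q) t"
        by (rule dist_triangle2)
      then have "e/2 \<le> dist (\<pi> p) t \<or> e/2 \<le> dist (\<pi> q) t"
        using pq(5) by linarith
      then show ?thesis using pq by blast
    qed
    obtain s where s: "\<And>k. s k \<in> D" "\<And>k. e/2 \<le> dist (\<pi> (s k)) t" "(\<lambda>k. F (s k)) \<longlonglongrightarrow> M"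
      by (rule maximizing_sequence[OF ne bdd far], assumption) (rule that, simp_all add: M_def)
    have "\<forall>\<^sub>F k in sequentially. dist (\<pi> (s k)) t < e/2"
      using t[OF s(1,3)] \<open>e > 0\<close> by (intro tendstoD) simp_all
    then have "\<forall>\<^sub>F k::nat in sequentially. False"
      by (rule eventually_mono) (meson s(2) not_less)
    then show False by simp
  qed
next
  define M where "M = (SUP p\<in>D. F p)"
  assume R: ?R
  \<comment> \<open>Used with two equal sequences for the Cauchy property, and with two different
    ones to see that they share their limit.\<close>
  have close: "\<exists>K. \<forall>k\<ge>K. \<forall>l\<ge>K. dist (\<pi> (s k)) (\<pi> (s' l)) < e"
    if s: "\<And>k. s k \<in> D" "(\<lambda>k. F (s k)) \<longlonglongrightarrow> M"
      and s': "\<And>k. s' k \<in> D" "(\<lambda>k. F (s' k)) \<longlonglongrightarrow> M" and "e > 0"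
    for s s' :: "nat \<Rightarrow> 'i" and e
  proof -
    obtain n where n: "inverse (real (Suc n)) < e"
      using reals_Archimedean[OF \<open>e > 0\<close>] by blast
    obtain c where c: "c < M"
      "\<And>p q. p \<in> D \<Longrightarrow> q \<in> D \<Longrightarrow> c < F p \<Longrightarrow> c < F q \<Longrightarrow> dist (\<pi> p) (\<pi> q) < inverse (real (Suc n))"
      using R unfolding near_maximizers_close_def M_def by meson
    obtain K where K: "\<And>k. k \<ge> K \<Longrightarrow> c < F (s k)"
      using order_tendstoD(1)[OF s(2) c(1)] unfolding eventually_sequentially by blast
    obtain L where L: "\<And>k. k \<ge> L \<Longrightarrow> c < F (s' k)"
      using order_tendstoD(1)[OF s'(2) c(1)] unfolding eventually_sequentially by blast
    have "dist (\<pi> (s k)) (\<pi> (s' l)) < e" if "k \<ge> max K L" "l \<ge> max K L" for k l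
      using c(2)[OF s(1) s'(1) K L, of k l] that n by simp
    then show ?thesis by blast
  qed
  obtain a where a: "\<And>k. a k \<in> D" "(\<lambda>k. F (a k)) \<longlonglongrightarrow> M"
  proof (rule maximizing_sequence[OF ne bdd, where P = "\<lambda>_. True"])
    show "\<exists>p\<in>D. c < F p \<and> True" if "c < (SUP p\<in>D. F p)" for c
      using that by (simp add: less_cSUP_iff[OF ne bdd])
  qed (rule that, simp_all add: M_def)
  have "Cauchy (\<lambda>k. \<pi> (a k))"
    using close[OF a a] by (intro metric_CauchyI) blast
  then obtain t where t: "(\<lambda>k. \<pi> (a k)) \<longlonglongrightarrow> t"
    using Cauchy_convergent convergent_def by blast
  have "?conv s t" if s: "\<And>k. s k \<in> D" "(\<lambda>k. F (s k)) \<longlonglongrightarrow> M" for s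
  proof (rule metric_LIMSEQ_I)
    fix e :: real assume "e > 0"
    then obtain K where K: "\<And>k l. k \<ge> K \<Longrightarrow> l \<ge> K \<Longrightarrow> dist (\<pi> (s k)) (\<pi> (a l)) < e/2"
      using close[OF s a, of "e/2"] by auto
    have "dist (\<pi> (s k)) t < e" if "k \<ge> K" for k
    proof -
      have "\<forall>\<^sub>F l in sequentially. dist (\<pi> (s k)) (\<pi> (a l)) \<le> e/2"
        using K[OF that] by (intro eventually_sequentiallyI[of K]) (simp add: less_imp_le)
      then have "dist (\<pi> (s k)) t \<le> e/2"
        by (intro tendsto_upperbound[OF tendsto_dist[OF tendsto_const t]]) simp_all
      then show ?thesis using \<open>e > 0\<close> by simp
    qed
    then show "\<exists>K. \<forall>k\<ge>K. dist (\<pi> (s k)) t < e" by blast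
  qed
  then show "\<exists>t. \<forall>s. ?max s \<longrightarrow> ?conv s t"
    unfolding M_def by blast
qed

section \<open>The abstract maximization problem: openness and density\<close>

text \<open>
  Instantiated with points \<open>p\<close> of the ball and \<open>N p = norm\<close>, and with states \<open>p = (x, \<phi>)\<close>, \<open>\<pi> p = x\<close>
  and \<open>N p v = cmod (\<phi> v)\<close>.
\<close>

locale ball_maximization =
  fixes D :: "'i set" and \<pi> :: "'i \<Rightarrow> 'a::complex_banach" and N :: "'i \<Rightarrow> 'a \<Rightarrow> real"
  assumes nonempty: "D \<noteq> {}"
    and in_ball: "p \<in> D \<Longrightarrow> \<pi> p \<in> cball 0 1"
    and le_norm: "p \<in> D \<Longrightarrow> N p v \<le> norm v"
    and subadditive: "p \<in> D \<Longrightarrow> N p (v + w) \<le> N p v + N p w"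
    and push: "p \<in> D \<Longrightarrow> norm (\<pi> p) = 1 \<Longrightarrow>
      \<exists>u. norm u = 1 \<and> (\<forall>e\<ge>0. N p v + e \<le> N p (v + e *\<^sub>R u))"
    and near_sphere: "f \<in> Au \<Longrightarrow> c < (SUP p\<in>D. N p (f (\<pi> p))) \<Longrightarrow>
      \<exists>p\<in>D. norm (\<pi> p) = 1 \<and> c < N p (f (\<pi> p))"
begin

lemma N_diff: "p \<in> D \<Longrightarrow> N p v \<le> N p w + norm (v - w)"
  using subadditive[of p w "v - w"] le_norm[of p "v - w"] by simp

lemma bdd_above_values:
  assumes "f \<in> Au"
  shows "bdd_above ((\<lambda>p. N p (f (\<pi> p))) ` D)"
proof -
  obtain B where "\<forall>y\<in>f ` cball 0 1. norm y \<le> B"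
    using assms unfolding Au_def bounded_iff by auto
  then have "N p (f (\<pi> p)) \<le> B" if "p \<in> D" for p
    using le_norm[OF that, of "f (\<pi> p)"] in_ball[OF that] by (meson image_eqI order_trans)
  then show ?thesis by (rule bdd_aboveI2)
qed

lemma value_le: "f \<in> Au \<Longrightarrow> p \<in> D \<Longrightarrow> N p (f (\<pi> p)) \<le> (SUP p\<in>D. N p (f (\<pi> p)))"
  using bdd_above_values by (intro cSUP_upper)

lemma ball_maximizing_sequence:
  assumes f: "f \<in> Au"
  obtains a :: "nat \<Rightarrow> 'i"
    where "\<And>k. a k \<in> D" "(\<lambda>k. N (a k) (f (\<pi> (a k)))) \<longlonglongrightarrow> (SUP p\<in>D. N p (f (\<pi> p)))"
proof (rule maximizing_sequence[OF nonempty bdd_above_values[OF f], where P = "\<lambda>_. True"])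
  show "\<exists>p\<in>D. c < N p (f (\<pi> p)) \<and> True" if "c < (SUP p\<in>D. N p (f (\<pi> p)))" for c
    using near_sphere[OF f that] by blast
qed (rule that)

lemma value_Au_dist:
  assumes "f \<in> Au" "g \<in> Au" "p \<in> D"
  shows "N p (f (\<pi> p)) \<le> N p (g (\<pi> p)) + mdist Au_metric f g"
  using N_diff[OF assms(3)] Au_dist_le[OF assms(1,2) in_ball[OF assms(3)]]
  by (meson add_left_mono order_trans)

text \<open>Each \<open>N p\<close> is 1-Lipschitz, so the values for \<open>g\<close> and
  \<open>f\<close> differ by at most their distance, uniformly in \<open>p\<close>, and a slightly
  raised level works for every nearby \<open>g\<close>.\<close>

lemma openin_near_maximizers_close:
  "openin Au_topology {f \<in> Au. near_maximizers_close D \<pi> (\<lambda>p. N p (f (\<pi> p))) e}"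
proof -
  interpret Metric_space "Au :: ('a \<Rightarrow> 'a) set" "mdist Au_metric"
    by (rule Metric_space_Au)
  show ?thesis
    unfolding mtopology_Au openin_mtopology
  proof (intro conjI allI impI)
    fix f assume "f \<in> {f \<in> Au. near_maximizers_close D \<pi> (\<lambda>p. N p (f (\<pi> p))) e}"
    then obtain c where f: "f \<in> Au" and c: "c < (SUP p\<in>D. N p (f (\<pi> p)))"
      "\<And>p q. p \<in> D \<Longrightarrow> q \<in> D \<Longrightarrow> c < N p (f (\<pi> p)) \<Longrightarrow> c < N q (f (\<pi> q)) \<Longrightarrow> dist (\<pi> p) (\<pi> q) < e"
      unfolding near_maximizers_close_def by blast
    obtain p0 where p0: "p0 \<in> D" "c < N p0 (f (\<pi> p0))"
      using c(1) less_cSUP_iff[OF nonempty bdd_above_values[OF f]] by blast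
    \<comment> \<open>Half the gap between \<open>c\<close> and a value above it: for
      \<open>g\<close> within \<open>r\<close> of \<open>f\<close>, the level \<open>c + r\<close>
      remains below the value of \<open>g\<close> at \<open>p0\<close>, and whatever exceeds
      \<open>c + r\<close> for \<open>g\<close> exceeds \<open>c\<close> for
      \<open>f\<close>.\<close>
    define r where "r = (N p0 (f (\<pi> p0)) - c) / 2"
    have r: "r > 0" using p0(2) by (simp add: r_def)
    have "near_maximizers_close D \<pi> (\<lambda>p. N p (g (\<pi> p))) e" if g: "g \<in> Au" "mdist Au_metric f g < r" for g
      unfolding near_maximizers_close_def
    proof (intro exI[of _ "c + r"] conjI ballI impI)
      have "c + r = N p0 (f (\<pi> p0)) - r" by (simp add: r_def field_simps)
      also have "\<dots> < N p0 (g (\<pi> p0))"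
        using value_Au_dist[OF f g(1) p0(1)] g(2) by linarith
      also have "\<dots> \<le> (SUP p\<in>D. N p (g (\<pi> p)))"
        using g(1) p0(1) by (rule value_le)
      finally show "c + r < (SUP p\<in>D. N p (g (\<pi> p)))" .
      fix p q assume pq: "p \<in> D" "q \<in> D" "c + r < N p (g (\<pi> p))" "c + r < N q (g (\<pi> q))"
      have "mdist Au_metric g f < r" using g(2) by (simp add: commute)
      then have "c < N p (f (\<pi> p))" "c < N q (f (\<pi> q))"
        using pq value_Au_dist[OF g(1) f] by force+
      then show "dist (\<pi> p) (\<pi> q) < e" using c(2) pq by blast
    qed
    then have "mball f r \<subseteq> {f \<in> Au. near_maximizers_close D \<pi> (\<lambda>p. N p (f (\<pi> p))) e}"
      by (auto simp: in_mball)
    with r show "\<exists>r>0. mball f r \<subseteq> {f \<in> Au. near_maximizers_close D \<pi> (\<lambda>p. N p (f (\<pi> p))) e}"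
      by blast
  qed blast
qed

text \<open>\<open>near_sphere\<close> puts the base point of an almost maximizing \<open>p0\<close>
  on the sphere, where a support functional exists; \<open>push\<close> gives a direction
  \<open>u\<close> in which \<open>N p0\<close> grows at full rate.\<close>

lemma dense_near_maximizers_close:
  assumes smooth: "smooth_space TYPE('a)" and luc: "locally_uniformly_convex TYPE('a)" and "e > 0"
  shows "Au_topology closure_of {f \<in> Au. near_maximizers_close D \<pi> (\<lambda>p. N p (f (\<pi> p))) e} = Au"
proof -
  interpret Metric_space "Au :: ('a \<Rightarrow> 'a) set" "mdist Au_metric"
    by (rule Metric_space_Au)
  have "\<exists>g\<in>{f \<in> Au. near_maximizers_close D \<pi> (\<lambda>p. N p (f (\<pi> p))) e}. g \<in> mcball f d"
    if f: "f \<in> Au" and "d > 0" for f d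
  proof -
    define M where "M = (SUP p\<in>D. N p (f (\<pi> p)))"
    obtain p0 where p0: "p0 \<in> D" "norm (\<pi> p0) = 1" "M - d/2 < N p0 (f (\<pi> p0))"
      using near_sphere[OF f, of "M - d/2"] \<open>d > 0\<close> unfolding M_def by auto
    obtain \<phi> where \<phi>: "\<phi> \<in> dual_ball" "blinfun_apply \<phi> (\<pi> p0) = 1"
      using norming_functional_unit[OF smooth p0(2)] by blast
    obtain u where u: "norm u = 1"
      "\<And>e. e \<ge> 0 \<Longrightarrow> N p0 (f (\<pi> p0)) + e \<le> N p0 (f (\<pi> p0) + e *\<^sub>R u)"
      using push[OF p0(1,2)] by blast
    have "e/2 > 0" using \<open>e > 0\<close> by simp
    then obtain n where
      n: "\<And>y. y \<in> cball 0 1 \<Longrightarrow> e/2 \<le> dist y (\<pi> p0) \<Longrightarrow> cmod (((1 + \<phi> y) / 2) ^ n) \<le> 1/2"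
      using peak_power_small[OF luc p0(2) \<phi>] by blast
    \<comment> \<open>Its modulus along \<open>\<phi>\<close> is at most \<open>d\<close> on the
      ball, equals \<open>d\<close> at \<open>\<pi> p0\<close>, and is at most \<open>d/2\<close> at
      distance \<open>e/2\<close> or more from \<open>\<pi> p0\<close>.\<close>
    define b where "b = (\<lambda>z::complex. of_real d * ((1 + z) / 2) ^ n)"
    define g where "g = restrict (\<lambda>y. f y + b (blinfun_apply \<phi> y) *\<^sub>C u) (cball 0 1)"
    have g: "g \<in> Au"
      unfolding g_def b_def using f \<phi>(1) by (rule Au_add_ridge) (intro holomorphic_intros, simp)
    have g_eq: "g y = f y + b (blinfun_apply \<phi> y) *\<^sub>C u" if "y \<in> cball 0 1" for y
      using that by (simp add: g_def)
    have b_le: "cmod (b (\<phi> y)) \<le> d" if "y \<in> cball 0 1" for y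
    proof -
      have "cmod (1 + \<phi> y) \<le> 1 + cmod (\<phi> y)"
        using norm_triangle_ineq[of 1 "\<phi> y"] by simp
      also have "\<dots> \<le> 2" using dual_ball_le[OF \<phi>(1), of y] that by simp
      finally have "cmod ((1 + \<phi> y) / 2) ^ n \<le> 1"
        by (intro power_le_one) (simp_all add: norm_divide)
      then have "d * cmod ((1 + \<phi> y) / 2) ^ n \<le> d * 1"
        using \<open>d > 0\<close> by (intro mult_left_mono) simp_all
      then show ?thesis
        using \<open>d > 0\<close> by (simp add: b_def norm_mult norm_power)
    qed
    have "mdist Au_metric f g \<le> d"
      using b_le by (intro Au_dist_least f g) (simp add: g_eq norm_scaleC u(1))
    then have "g \<in> mcball f d" using f g by simp
    moreover have "near_maximizers_close D \<pi> (\<lambda>p. N p (g (\<pi> p))) e"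
      unfolding near_maximizers_close_def
    \<comment> \<open>The level \<open>M + d/2\<close> separates: the value of \<open>g\<close> at
      \<open>p0\<close> exceeds \<open>(M - d/2) + d\<close>, whereas values with base point at
      least \<open>e/2\<close> away from \<open>\<pi> p0\<close> are at most
      \<open>M + d/2\<close>.\<close>
    proof (intro exI[of _ "M + d/2"] conjI ballI impI)
      have "b (\<phi> (\<pi> p0)) *\<^sub>C u = d *\<^sub>R u"
        by (simp add: b_def \<phi>(2) scaleR_scaleC)
      then have "N p0 (f (\<pi> p0)) + d \<le> N p0 (g (\<pi> p0))"
        using u(2)[of d] \<open>d > 0\<close> by (simp add: g_eq in_ball[OF p0(1)] p0(2))
      also have "\<dots> \<le> (SUP p\<in>D. N p (g (\<pi> p)))"
        using g p0(1) by (rule value_le)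
      finally show "M + d/2 < (SUP p\<in>D. N p (g (\<pi> p)))"
        using p0(3) by linarith
      have near: "dist (\<pi> p) (\<pi> p0) < e/2" if p: "p \<in> D" "M + d/2 < N p (g (\<pi> p))" for p
      proof (rule ccontr)
        assume "\<not> ?thesis"
        then have "cmod (b (\<phi> (\<pi> p))) \<le> d/2"
          using n[OF in_ball[OF p(1)]] \<open>d > 0\<close> by (simp add: b_def norm_mult)
        then have "N p (g (\<pi> p)) \<le> N p (f (\<pi> p)) + d/2"
          using N_diff[OF p(1), of "g (\<pi> p)" "f (\<pi> p)"]
          by (simp add: g_eq[OF in_ball[OF p(1)]] norm_scaleC u(1))
        also have "\<dots> \<le> M + d/2"
          unfolding M_def using value_le[OF f p(1)] by simp
        finally show False using p(2) by simp
      qed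
      fix p q assume "p \<in> D" "q \<in> D" "M + d/2 < N p (g (\<pi> p))" "M + d/2 < N q (g (\<pi> q))"
      then show "dist (\<pi> p) (\<pi> q) < e"
        using near[of p] near[of q] dist_triangle2[of "\<pi> p" "\<pi> q" "\<pi> p0"] by simp
    qed
    ultimately show ?thesis using g by blast
  qed
  then show ?thesis
    unfolding mtopology_Au metric_closure_of_alt by blast
qed

end

section \<open>The two kinds of peak functions\<close>

text \<open>A functional norming \<open>f x\<close> and the complex line through 0 and
  \<open>x\<close> reduce this to the maximum modulus principle on the unit disc.\<close>

lemma Au_maximum_modulus:
  fixes f :: "'a::complex_banach \<Rightarrow> 'a"
  assumes smooth: "smooth_space TYPE('a)" and nontrivial: "\<exists>x::'a. x \<noteq> 0"
    and f: "f \<in> Au" and x: "x \<in> cball 0 1"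
    and B: "\<And>y. norm y = 1 \<Longrightarrow> norm (f y) \<le> B"
  shows "norm (f x) \<le> B"
proof -
  obtain w :: 'a where w: "norm w = 1" "x = of_real (norm x) *\<^sub>C w"
    using unit_direction[OF nontrivial] unfolding scaleR_scaleC by blast
  obtain \<phi> where \<phi>: "\<phi> \<in> dual_ball" "blinfun_apply \<phi> (f x) = of_real (norm (f x))"
    using norming_functional[OF smooth nontrivial] by blast
  \<comment> \<open>The boundary circle of this disc is mapped into the unit sphere, and
    \<open>g\<close> takes the value \<open>norm (f x)\<close> at \<open>norm x\<close>.\<close>
  define g where "g = (\<lambda>\<zeta>. blinfun_apply \<phi> (f (0 + \<zeta> *\<^sub>C w)))"
  have ball: "ball 0 1 \<subseteq> interior (cball (0::'a) 1)"
    by (intro interior_maximal ball_subset_cball open_ball)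
  have "cmod (g (of_real (norm x))) \<le> B"
  proof (rule maximum_modulus_frontier[where f = g and S = "cball 0 1"])
    have hol: "holomorphic_map_on f (interior (cball 0 1))" using f by (simp add: Au_def)
    have "0 + \<zeta> *\<^sub>C w \<in> interior (cball 0 1)" if "\<zeta> \<in> ball 0 1" for \<zeta>
      using that by (intro subsetD[OF ball]) (simp add: norm_scaleC w(1))
    from slice_holomorphic[OF hol \<phi>(1) this]
    show "g holomorphic_on interior (cball 0 1)"
      unfolding g_def interior_cball by blast
    have "continuous_on (cball 0 1) f"
      using f by (auto simp: Au_def intro: uniformly_continuous_imp_continuous)
    moreover have "continuous_on (cball 0 1) (\<lambda>\<zeta>. 0 + \<zeta> *\<^sub>C w)"
      by (intro continuous_on_add continuous_on_const linear_continuous_on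
          bounded_bilinear.bounded_linear_left[OF bounded_bilinear_scaleC])
    ultimately have "continuous_on (cball 0 1) (\<lambda>\<zeta>. f (0 + \<zeta> *\<^sub>C w))"
      by (rule continuous_on_compose2) (auto simp: norm_scaleC w(1))
    then show "continuous_on (closure (cball 0 1)) g"
      unfolding g_def closure_closed[OF closed_cball] by (rule bounded_linear.continuous_on[OF blinfun.bounded_linear_right])
    show "cmod (g \<zeta>) \<le> B" if "\<zeta> \<in> frontier (cball 0 1)" for \<zeta>
      using dual_ball_le[OF \<phi>(1)] B[of "0 + \<zeta> *\<^sub>C w"] that
      unfolding g_def by (force simp: norm_scaleC w(1) intro: order_trans)
  qed (use x in auto)
  then show ?thesis
    using w(2) by (simp add: g_def \<phi>(2))
qed

text \<open>The required \<open>u\<close> is the direction of \<open>v\<close>, along which the norm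
  grows additively; for \<open>v = 0\<close> the unit vector \<open>p\<close> serves. That almost
  maximal values occur on the sphere is the maximum modulus principle.\<close>

lemma ball_maximization_norm:
  assumes smooth: "smooth_space TYPE('a::complex_banach)" and nontrivial: "\<exists>x::'a. x \<noteq> 0"
  shows "ball_maximization (cball (0::'a) 1) (\<lambda>x. x) (\<lambda>_. norm)"
proof
  fix p v :: 'a assume p: "norm p = 1"
  define u where "u = (if v = 0 then p else sgn v)"
  have "norm u = 1" by (simp add: u_def p norm_sgn)
  moreover have "v = norm v *\<^sub>R u" by (simp add: u_def sgn_div_norm)
  then have "v + e *\<^sub>R u = (norm v + e) *\<^sub>R u" for e
    by (metis scaleR_add_left)
  ultimately show "\<exists>u. norm u = 1 \<and> (\<forall>e\<ge>0. norm v + e \<le> norm (v + e *\<^sub>R u))"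
    by (intro exI[of _ u]) simp
next
  fix f :: "'a \<Rightarrow> 'a" and c assume f: "f \<in> Au" and "c < (SUP p\<in>cball 0 1. norm (f p))"
  then obtain x where x: "x \<in> cball 0 1" "c < norm (f x)"
    using less_cSupD[of "(\<lambda>p. norm (f p)) ` cball 0 1" c] by auto
  have "\<exists>y. norm y = 1 \<and> c < norm (f y)"
    using Au_maximum_modulus[OF smooth nontrivial f x(1), of c] x(2) by (meson not_less)
  then show "\<exists>p\<in>cball 0 1. norm p = 1 \<and> c < norm (f p)" by auto
qed (auto simp: norm_triangle_ineq)

section \<open>States and their topology\<close>

lemma state_pairs_norm:
  assumes "p \<in> state_pairs"
  shows "norm (fst p) = 1"
proof -
  have "fst p \<in> cball 0 1" "snd p \<in> dual_ball" "snd p (fst p) = 1"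
    using assms by (auto simp: state_pairs_def)
  then show ?thesis
    using dual_ball_le[of "snd p" "fst p"] by simp
qed

lemma state_pairs_nonempty:
  assumes smooth: "smooth_space TYPE('a::complex_normed_vector)" and nontrivial: "\<exists>x::'a. x \<noteq> 0"
  shows "(state_pairs :: ('a \<times> ('a \<Rightarrow>\<^sub>L complex)) set) \<noteq> {}"
proof -
  obtain w :: 'a where w: "norm w = 1"
    using unit_direction[OF nontrivial] by blast
  obtain \<phi> where "\<phi> \<in> dual_ball" "blinfun_apply \<phi> w = 1"
    using norming_functional_unit[OF smooth w] by blast
  then have "(w, \<phi>) \<in> state_pairs"
    using w by (simp add: state_pairs_def)
  then show ?thesis by blast
qed

text \<open>Here \<open>u\<close> is the base point itself, rotated so that the functional sends it
  to the phase of its value at \<open>v\<close>. Base points of states always have norm 1, so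
  \<open>near_sphere\<close> holds for every almost maximal state.\<close>

lemma ball_maximization_numerical:
  assumes smooth: "smooth_space TYPE('a::complex_banach)" and nontrivial: "\<exists>x::'a. x \<noteq> 0"
  shows "ball_maximization (state_pairs :: ('a \<times> ('a \<Rightarrow>\<^sub>L complex)) set) fst
    (\<lambda>p v. cmod (blinfun_apply (snd p) v))"
proof
  show "(state_pairs :: ('a \<times> ('a \<Rightarrow>\<^sub>L complex)) set) \<noteq> {}"
    using smooth nontrivial by (rule state_pairs_nonempty)
next
  fix p :: "'a \<times> ('a \<Rightarrow>\<^sub>L complex)" and v w :: 'a
  assume p: "p \<in> state_pairs"
  then show "fst p \<in> cball 0 1" by (auto simp: state_pairs_def)
  have \<phi>: "snd p \<in> dual_ball" "snd p (fst p) = 1" using p by (auto simp: state_pairs_def)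
  then show "cmod (snd p v) \<le> norm v" by (intro dual_ball_le)
  show "cmod (snd p (v + w)) \<le> cmod (snd p v) + cmod (snd p w)"
    by (simp add: blinfun.add_right norm_triangle_ineq)
  \<comment> \<open>The phase of \<open>\<phi> v\<close>, or 1 by default when this value
    vanishes.\<close>
  define c where "c = (if snd p v = 0 then 1 else sgn (snd p v))"
  have c: "cmod c = 1" by (simp add: c_def norm_sgn)
  have "snd p v = of_real (cmod (snd p v)) * c"
    by (simp add: c_def sgn_eq)
  then have "snd p (v + e *\<^sub>R (c *\<^sub>C fst p)) = of_real (cmod (snd p v) + e) * c" for e
    by (simp add: blinfun.add_right blinfun.scaleR_right dual_ball_scaleC[OF \<phi>(1)] \<phi>(2)
        scaleR_conv_of_real distrib_right)
  then have "cmod (snd p (v + e *\<^sub>R (c *\<^sub>C fst p))) = \<bar>cmod (snd p v) + e\<bar>" for e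
    by (simp only: norm_mult c norm_of_real mult_1_right)
  then show "\<exists>u. norm u = 1 \<and> (\<forall>e\<ge>0. cmod (snd p v) + e \<le> cmod (snd p (v + e *\<^sub>R u)))"
    using c state_pairs_norm[OF p] by (intro exI[of _ "c *\<^sub>C fst p"]) (simp add: norm_scaleC)
next
  fix f :: "'a \<Rightarrow> 'a" and c
  assume "c < (SUP p\<in>state_pairs. cmod (blinfun_apply (snd p) (f (fst p))))"
  then show "\<exists>p\<in>state_pairs. norm (fst p) = 1 \<and> c < cmod (blinfun_apply (snd p) (f (fst p)))"
    using less_cSupD[of "(\<lambda>p. cmod (blinfun_apply (snd p) (f (fst p)))) ` state_pairs" c]
      state_pairs_nonempty[OF smooth nontrivial] state_pairs_norm by auto
qed

text \<open>The strong operator topology is the pullback of the product topology along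
  \<open>blinfun_apply\<close>, and convergence in a product is coordinatewise.\<close>

lemma limitin_strong_operator_topologyI:
  assumes "\<And>y. ((\<lambda>n. blinfun_apply (T n) y) \<longlongrightarrow> blinfun_apply S y) F"
  shows "limitin strong_operator_topology T S F"
proof -
  have "limitin (product_topology (\<lambda>_. euclidean) UNIV) (\<lambda>n. blinfun_apply (T n)) (blinfun_apply S) F"
    using assms by (simp add: limitin_componentwise)
  then have lim: "((\<lambda>n. blinfun_apply (T n)) \<longlongrightarrow> blinfun_apply S) F"
    by (simp add: euclidean_product_topology)
  show ?thesis
    unfolding limitin_def strong_operator_topology_topspace
  proof (intro conjI allI impI UNIV_I)
    fix U assume "openin strong_operator_topology U \<and> S \<in> U"
    then obtain V where "open V" "U = blinfun_apply -` V" "S \<in> U"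
      unfolding strong_operator_topology_def openin_pullback_topology by auto
    then show "\<forall>\<^sub>F n in F. T n \<in> U"
      using topological_tendstoD[OF lim] by simp
  qed
qed

lemma limitin_state_pairs_topologyI:
  assumes "\<And>n. s n \<in> state_pairs" "p \<in> state_pairs"
    and "(\<lambda>n. fst (s n)) \<longlonglongrightarrow> fst p"
    and "\<And>y. (\<lambda>n. blinfun_apply (snd (s n)) y) \<longlonglongrightarrow> blinfun_apply (snd p) y"
  shows "limitin state_pairs_topology s p sequentially"
proof -
  have "limitin strong_operator_topology (snd \<circ> s) (snd p) sequentially"
    using assms(4) by (intro limitin_strong_operator_topologyI) (simp add: o_def)
  moreover have "fst q \<in> cball 0 1" "snd q \<in> dual_ball"
    if "q \<in> state_pairs" for q :: "'a \<times> ('a \<Rightarrow>\<^sub>L complex)"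
    using that by (auto simp: state_pairs_def)
  ultimately show ?thesis
    using assms(1-3) unfolding state_pairs_topology_def weak_star_dual_ball_def
    by (simp add: limitin_subtopology limitin_pairwise o_def)
qed

lemma limitin_state_pairs_topology_fst:
  assumes "limitin state_pairs_topology s p sequentially"
  shows "(\<lambda>n. fst (s n)) \<longlonglongrightarrow> fst p"
  using assms unfolding state_pairs_topology_def
  by (simp add: limitin_subtopology limitin_pairwise o_def)

lemma numerical_radius_eq:
  "numerical_radius f = (SUP p\<in>state_pairs. cmod (blinfun_apply (snd p) (f (fst p))))"
  by (simp add: numerical_radius_def case_prod_beta)

section \<open>Peak functions in terms of near maximizers\<close>

text \<open>Besides the equivalence for maximizing sequences, two points need care: the common limit
  lies in the ball because the ball is closed, and the zero function violates the right-hand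
  side.\<close>

lemma strong_peak_function_iff:
  fixes f :: "'a::complex_banach \<Rightarrow> 'a"
  assumes smooth: "smooth_space TYPE('a)" and nontrivial: "\<exists>x::'a. x \<noteq> 0"
  shows "strong_peak_function f \<longleftrightarrow> f \<in> Au \<and>
    (\<forall>n. near_maximizers_close (cball 0 1) (\<lambda>x. x) (\<lambda>x. norm (f x)) (inverse (real (Suc n))))"
    (is "_ \<longleftrightarrow> _ \<and> ?R")
proof (cases "f \<in> Au")
  case f: True
  interpret ball_maximization "cball (0::'a) 1" "\<lambda>x. x" "\<lambda>_. norm"
    using smooth nontrivial by (rule ball_maximization_norm)
  note iff = maximizing_sequences_converge_iff[OF nonempty bdd_above_values[OF f], where \<pi> = "\<lambda>x. x"]
  show ?thesis
  proof
    assume "strong_peak_function f"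
    then obtain t where "\<forall>s. (\<forall>k. s k \<in> cball 0 1) \<and>
        (\<lambda>k. norm (f (s k))) \<longlonglongrightarrow> (SUP p\<in>cball 0 1. norm (f p)) \<longrightarrow> s \<longlonglongrightarrow> t"
      unfolding strong_peak_function_def Au_norm_def by auto
    then show "f \<in> Au \<and> ?R"
      using f iff by auto
  next
    assume "f \<in> Au \<and> ?R"
    then have R: ?R by blast
    then obtain t where t: "\<And>s. (\<And>k. s k \<in> cball 0 1) \<Longrightarrow>
        (\<lambda>k. norm (f (s k))) \<longlonglongrightarrow> (SUP p\<in>cball 0 1. norm (f p)) \<Longrightarrow> s \<longlonglongrightarrow> t"
      unfolding iff[symmetric] by blast
    obtain a where a: "\<And>k. a k \<in> cball 0 1"
      "(\<lambda>k. norm (f (a k))) \<longlonglongrightarrow> (SUP p\<in>cball 0 1. norm (f p))"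
      by (rule ball_maximizing_sequence[OF f]) (rule that)
    have "t \<in> cball 0 1"
      using closed_cball a(1) t[OF a] by (rule closed_sequentially)
    moreover have "\<exists>x\<in>cball 0 1. f x \<noteq> 0"
    proof (rule ccontr)
      assume "\<not> ?thesis"
      then have zero: "f x = 0" if "x \<in> cball 0 1" for x using that by blast
      obtain w :: 'a where w: "norm w = 1"
        using unit_direction[OF nontrivial] by blast
      \<comment> \<open>For \<open>n = 0\<close> the tolerance is 1, but for the zero function both
        \<open>w\<close> and 0 are maximizers, at distance exactly 1.\<close>
      from R have "near_maximizers_close (cball 0 1) (\<lambda>x. x) (\<lambda>x. norm (f x)) (inverse (real (Suc 0)))"
        by blast
      then obtain c where "c < (SUP p\<in>cball 0 1. norm (f p))"
        "\<And>p q. p \<in> cball 0 1 \<Longrightarrow> q \<in> cball 0 1 \<Longrightarrow> c < norm (f p) \<Longrightarrow> c < norm (f q) \<Longrightarrow> dist p q < 1"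
        unfolding near_maximizers_close_def by auto
      from this(1) this(2)[of w 0] show False
        using w by (simp add: zero cong: SUP_cong_simp)
    qed
    ultimately show "strong_peak_function f"
      using f t unfolding strong_peak_function_def Au_norm_def by blast
  qed
qed (simp add: strong_peak_function_def)

text \<open>One direction projects to base points. For the other, the limit \<open>t\<close> of the
  base points has norm 1, its support functional completes it to a state, and continuity of the
  duality map makes the functionals converge as well.\<close>

lemma numerical_strong_peak_function_iff:
  fixes f :: "'a::complex_banach \<Rightarrow> 'a"
  assumes smooth: "smooth_space TYPE('a)" and nontrivial: "\<exists>x::'a. x \<noteq> 0"
  shows "numerical_strong_peak_function f \<longleftrightarrow> f \<in> Au \<and>
    (\<forall>n. near_maximizers_close state_pairs fst
      (\<lambda>p. cmod (blinfun_apply (snd p) (f (fst p)))) (inverse (real (Suc n))))"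
    (is "_ \<longleftrightarrow> _ \<and> ?R")
proof (cases "f \<in> Au")
  let ?M = "SUP p\<in>state_pairs. cmod (blinfun_apply (snd p) (f (fst p)))"
  case f: True
  interpret ball_maximization "state_pairs :: ('a \<times> ('a \<Rightarrow>\<^sub>L complex)) set" fst
    "\<lambda>p v. cmod (blinfun_apply (snd p) v)"
    using smooth nontrivial by (rule ball_maximization_numerical)
  note iff = maximizing_sequences_converge_iff[OF nonempty bdd_above_values[OF f], where \<pi> = fst]
  show ?thesis
  proof
    assume "numerical_strong_peak_function f"
    then obtain p where p: "\<forall>s. (\<forall>k. s k \<in> state_pairs) \<and>
        (\<lambda>k. cmod (blinfun_apply (snd (s k)) (f (fst (s k)))))
          \<longlonglongrightarrow> ?M
        \<longrightarrow> limitin state_pairs_topology s p sequentially"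
      unfolding numerical_strong_peak_function_def numerical_radius_eq by auto
    then have "\<forall>s. (\<forall>k. s k \<in> state_pairs) \<and>
        (\<lambda>k. cmod (blinfun_apply (snd (s k)) (f (fst (s k)))))
          \<longlonglongrightarrow> ?M
        \<longrightarrow> (\<lambda>k. fst (s k)) \<longlonglongrightarrow> fst p"
      by (intro allI impI limitin_state_pairs_topology_fst) simp
    then show "f \<in> Au \<and> ?R"
      using f iff by auto
  next
    assume "f \<in> Au \<and> ?R"
    then have ?R by blast
    then obtain t where t: "\<And>s. (\<And>k. s k \<in> state_pairs) \<Longrightarrow>
        (\<lambda>k. cmod (blinfun_apply (snd (s k)) (f (fst (s k))))) \<longlonglongrightarrow> ?M \<Longrightarrow>
        (\<lambda>k. fst (s k)) \<longlonglongrightarrow> t"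
      unfolding iff[symmetric] by blast
    obtain a where a: "\<And>k. a k \<in> state_pairs"
      "(\<lambda>k. cmod (blinfun_apply (snd (a k)) (f (fst (a k))))) \<longlonglongrightarrow> ?M"
      by (rule ball_maximizing_sequence[OF f]) (rule that)
    have "(\<lambda>k. norm (fst (a k))) \<longlonglongrightarrow> norm t"
      using t[OF a] by (rule tendsto_norm)
    then have norm_t: "norm t = 1"
      by (simp add: state_pairs_norm[OF a(1)] LIMSEQ_const_iff)
    obtain \<phi> where \<phi>: "\<phi> \<in> dual_ball" "blinfun_apply \<phi> t = 1"
      using norming_functional_unit[OF smooth norm_t] by blast
    have p: "(t, \<phi>) \<in> state_pairs"
      using norm_t \<phi> by (simp add: state_pairs_def)
    have "limitin state_pairs_topology s (t, \<phi>) sequentially"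
      if s: "\<And>k. s k \<in> state_pairs"
        "(\<lambda>k. cmod (blinfun_apply (snd (s k)) (f (fst (s k))))) \<longlonglongrightarrow> ?M" for s
    proof (rule limitin_state_pairs_topologyI[OF s(1) p])
      show "(\<lambda>k. fst (s k)) \<longlonglongrightarrow> fst (t, \<phi>)" using t[OF s] by simp
      have "snd (s k) \<in> dual_ball" "snd (s k) (fst (s k)) = 1" for k
        using s(1)[of k] by (auto simp: state_pairs_def)
      from duality_map_continuous[OF smooth norm_t \<phi> this t[OF s]]
      show "(\<lambda>k. blinfun_apply (snd (s k)) y) \<longlonglongrightarrow> blinfun_apply (snd (t, \<phi>)) y" for y
        by simp
    qed
    with p f show "numerical_strong_peak_function f"
      unfolding numerical_strong_peak_function_def numerical_radius_eq by blast
  qed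
qed (simp add: numerical_strong_peak_function_def)

theorem corollary3p3:
  assumes nontrivial: "\<exists>x::'a::complex_banach. x \<noteq> 0"
    and separable: "separable_space (euclidean :: 'a topology)"
    and smooth: "smooth_space TYPE('a)"
    and luc: "locally_uniformly_convex TYPE('a)"
  shows "gdelta_in Au_topology
           {f :: 'a \<Rightarrow> 'a. strong_peak_function f \<and> numerical_strong_peak_function f} \<and>
         Au_topology closure_of
           {f :: 'a \<Rightarrow> 'a. strong_peak_function f \<and> numerical_strong_peak_function f}
           = topspace Au_topology"
proof -
  interpret Au: Metric_space "Au :: ('a \<Rightarrow> 'a) set" "mdist Au_metric"
    by (rule Metric_space_Au)
  interpret peak: ball_maximization "cball (0::'a) 1" "\<lambda>x. x" "\<lambda>_. norm"
    using smooth nontrivial by (rule ball_maximization_norm)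
  interpret num: ball_maximization "state_pairs :: ('a \<times> ('a \<Rightarrow>\<^sub>L complex)) set" fst
    "\<lambda>p v. cmod (blinfun_apply (snd p) v)"
    using smooth nontrivial by (rule ball_maximization_numerical)
  define U where "U = (\<lambda>n. {f \<in> Au. near_maximizers_close (cball (0::'a) 1) (\<lambda>x. x)
    (\<lambda>x. norm (f x)) (inverse (real (Suc n)))})"
  define V where "V = (\<lambda>n. {f \<in> Au. near_maximizers_close
    (state_pairs :: ('a \<times> ('a \<Rightarrow>\<^sub>L complex)) set) fst
    (\<lambda>p. cmod (blinfun_apply (snd p) (f (fst p)))) (inverse (real (Suc n)))})"
  \<comment> \<open>Pooling the open dense sets of both kinds in one countable family lets a single
    use of Baire's theorem give density of their common intersection.\<close>
  define G where "G = range U \<union> range V"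
  have eq: "{f :: 'a \<Rightarrow> 'a. strong_peak_function f \<and> numerical_strong_peak_function f} = \<Inter>G"
    by (auto simp: G_def U_def V_def strong_peak_function_iff[OF smooth nontrivial]
        numerical_strong_peak_function_iff[OF smooth nontrivial])
  have G: "countable G" "G \<noteq> {}" by (auto simp: G_def)
  have open_dense: "openin Au_topology T \<and> Au_topology closure_of T = Au" if "T \<in> G" for T
    using that unfolding G_def U_def V_def
    by (auto intro!: peak.openin_near_maximizers_close num.openin_near_maximizers_close
        peak.dense_near_maximizers_close[OF smooth luc] num.dense_near_maximizers_close[OF smooth luc]
        simp del: of_nat_Suc)
  have "gdelta_in Au_topology (\<Inter>G)"
    using G open_dense by (intro gdelta_in_Inter open_imp_gdelta_in) auto
  moreover have "Au_topology closure_of \<Inter>G = topspace Au_topology"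
    using Au.metric_Baire_category[OF mcomplete_Au[OF smooth nontrivial] G(1)] open_dense
    by (simp add: mtopology_Au)
  ultimately show ?thesis
    unfolding eq by blast
qed

end
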